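(* Let $f\in C^2(\mathbb{R})$ and $g\in C^1(\mathbb{R})$ satisfy $f''(u)>0$ and $g'(u)>0$ for every $u\in\mathbb{R}$. Let $u_-,u_+\in\mathbb{R}$ with $u_+\neq u_-$, let $c=\dfrac{f(u_+)-f(u_-)}{u_+-u_-}$ (Rankine--Hugoniot relation), and assume the Lax condition $f'(u_+)<c<f'(u_-)$. Assume moreover that $u_\pm$ are such that the inviscid profile connecting $u_-$ to $u_+$ (defined in the context) undergoes a sub-shock in the $u$ variable. Then there exists $\epsilon_0>0$ such that for every $\epsilon\in(0,\epsilon_0)$ the parabolic-elliptic system $$ \partial_t u+\partial_x f(u)-\epsilon\,\partial_{xx}u=\partial_x v,\qquad v-\partial_{xx}v=\partial_x g(u) $$ supports a propagating front with asymptotic states $u_\pm$ and with speed $c$ given by the Rankine--Hugoniot relation above.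
   Context: Propagating front: given $u_\pm\in\mathbb{R}$, a propagating front for the system is a triple $(u,v;c)$ where $c\in\mathbb{R}$ is a constant (the speed) and $(u,v)=(u,v)(x-ct)$ is a travelling wave solution of the system (the profile) satisfying the asymptotic conditions $(u,v)(\pm\infty)=(u_\pm,0)$. Inviscid profile: this is the profile of the propagating front, with speed $c$ and asymptotic states $u_\pm$, of the system with $\epsilon=0$, i.e. $\partial_t u+\partial_x f(u)=\partial_x v$, $v-\partial_{xx}v=\partial_x g(u)$. Put $f_c(u):=f(u)-cu$, so that $f_c(u_+)=f_c(u_-)$; this common value is denoted $f_c(u_\pm)$. The inviscid profile is a pair $(u,v)$ of functions of the travelling variable $x$ (written in place of $x-ct$), unique up to translation, for which there are a point $x_*\in\mathbb{R}$ and a function $w$ such that $u\in C^1(\mathbb{R}\setminus\{x_*\})$ with at most a jump discontinuity at $x_*$, $v\in C^0(\mathbb{R})\cap C^1(\mathbb{R}\setminus\{x_*\})$, $w\in C^1(\mathbb{R})\cap C^2(\mathbb{R}\setminus\{x_*\})$, $$ v=f_c(u)-f_c(u_\pm),\qquad v'=w-g(u),\qquad w'=v\qquad\text{on }\mathbb{R}\setminus\{x_*\}, $$ $(u,v,w)(\pm\infty)=(u_\pm,0,g(u_\pm))$, and, if $u$ is discontinuous at $x_*$, the jump is admissible (entropic), i.e. $u(x_*^-)>u(x_*^+)$. The inviscid profile is said to undergo a sub-shock in the $u$ variable if $u$ has a (genuine) jump discontinuity at $x_*$. *)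

theory Defs
  imports "HOL-Analysis.Analysis"
begin

definition C2_differentiable_on :: "(real \<Rightarrow> real) \<Rightarrow> real set \<Rightarrow> bool"
    (infix \<open>C2'_differentiable'_on\<close> 50) where
  "h C2_differentiable_on S \<longleftrightarrow>
     (\<exists>D. (\<forall>x\<in>S. (h has_real_derivative D x) (at x)) \<and> D C1_differentiable_on S)"

definition jointly_continuous :: "(real \<Rightarrow> real \<Rightarrow> real) \<Rightarrow> bool" where
  "jointly_continuous h \<longleftrightarrow> continuous_on UNIV (\<lambda>(t, x). h t x)"

text \<open>
  Classical solutions on the whole plane of
  \[
    \partial_t u + \partial_x f(u) - \epsilon \partial_{xx} u = \partial_x v, \qquad
    v - \partial_{xx} v = \partial_x g(u).
  \]
  The unknowns are functions of \<open>t\<close> (first argument) and \<open>x\<close> (second argument);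
  \<open>ut\<close>, \<open>ux\<close>, \<open>uxx\<close>, \<open>vx\<close>, \<open>vxx\<close> are their partial derivatives.
\<close>

definition classical_solution ::
  "(real \<Rightarrow> real) \<Rightarrow> (real \<Rightarrow> real) \<Rightarrow> real \<Rightarrow> (real \<Rightarrow> real \<Rightarrow> real) \<Rightarrow> (real \<Rightarrow> real \<Rightarrow> real) \<Rightarrow> bool"
where
  "classical_solution f g \<epsilon> u v \<longleftrightarrow>
     (\<exists>ut ux uxx vx vxx.
        (\<forall>h \<in> {u, ut, ux, uxx, v, vx, vxx}. jointly_continuous h) \<and>
        (\<forall>t x.
           ((\<lambda>s. u s x) has_real_derivative ut t x) (at t) \<and>
           (u t has_real_derivative ux t x) (at x) \<and>
           (ux t has_real_derivative uxx t x) (at x) \<and>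
           (v t has_real_derivative vx t x) (at x) \<and>
           (vx t has_real_derivative vxx t x) (at x) \<and>
           (\<lambda>y. f (u t y)) differentiable (at x) \<and>
           (\<lambda>y. g (u t y)) differentiable (at x) \<and>
           ut t x + deriv (\<lambda>y. f (u t y)) x - \<epsilon> * uxx t x = vx t x \<and>
           v t x - vxx t x = deriv (\<lambda>y. g (u t y)) x))"

definition propagating_front ::
  "(real \<Rightarrow> real) \<Rightarrow> (real \<Rightarrow> real) \<Rightarrow> real \<Rightarrow> real \<Rightarrow> real \<Rightarrow> (real \<Rightarrow> real) \<Rightarrow> (real \<Rightarrow> real) \<Rightarrow> real \<Rightarrow> bool"
where
  "propagating_front f g \<epsilon> um up U V c \<longleftrightarrow>
     classical_solution f g \<epsilon> (\<lambda>t x. U (x - c * t)) (\<lambda>t x. V (x - c * t)) \<and>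
     (U \<longlongrightarrow> um) at_bot \<and> (V \<longlongrightarrow> 0) at_bot \<and>
     (U \<longlongrightarrow> up) at_top \<and> (V \<longlongrightarrow> 0) at_top"

definition reduced_flux :: "(real \<Rightarrow> real) \<Rightarrow> real \<Rightarrow> real \<Rightarrow> real" where
  "reduced_flux f c s = f s - c * s"

text \<open>
  Profiles \<open>(u, v)\<close> of the system with \<open>\<epsilon> = 0\<close>, with auxiliary function \<open>w\<close> and
  exceptional point \<open>xs\<close>. The reduced flux takes the same value at both asymptotic states,
  as the Rankine--Hugoniot relation requires; the value of \<open>v\<close> at \<open>xs\<close> is fixed by continuity.
  The limits \<open>ul\<close>, \<open>ur\<close> say that \<open>u\<close> has at most a jump at \<open>xs\<close>.
\<close>

definition inviscid_profile ::
  "(real \<Rightarrow> real) \<Rightarrow> (real \<Rightarrow> real) \<Rightarrow> real \<Rightarrow> real \<Rightarrow> real \<Rightarrow>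
   (real \<Rightarrow> real) \<Rightarrow> (real \<Rightarrow> real) \<Rightarrow> (real \<Rightarrow> real) \<Rightarrow> real \<Rightarrow> bool"
where
  "inviscid_profile f g c um up u v w xs \<longleftrightarrow>
     u C1_differentiable_on (- {xs}) \<and>
     (\<exists>ul ur. (u \<longlongrightarrow> ul) (at_left xs) \<and> (u \<longlongrightarrow> ur) (at_right xs) \<and>
              (\<not> isCont u xs \<longrightarrow> ul > ur)) \<and>
     continuous_on UNIV v \<and> v C1_differentiable_on (- {xs}) \<and>
     w C1_differentiable_on UNIV \<and> w C2_differentiable_on (- {xs}) \<and>
     reduced_flux f c up = reduced_flux f c um \<and>
     (\<forall>x. x \<noteq> xs \<longrightarrow>
        v x = reduced_flux f c (u x) - reduced_flux f c um \<and>
        (v has_real_derivative (w x - g (u x))) (at x) \<and>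
        (w has_real_derivative v x) (at x)) \<and>
     (u \<longlongrightarrow> um) at_bot \<and> (v \<longlongrightarrow> 0) at_bot \<and> (w \<longlongrightarrow> g um) at_bot \<and>
     (u \<longlongrightarrow> up) at_top \<and> (v \<longlongrightarrow> 0) at_top \<and> (w \<longlongrightarrow> g up) at_top"

definition jump_at :: "(real \<Rightarrow> real) \<Rightarrow> real \<Rightarrow> bool" where
  "jump_at u xs \<longleftrightarrow>
     (\<exists>ul ur. (u \<longlongrightarrow> ul) (at_left xs) \<and> (u \<longlongrightarrow> ur) (at_right xs) \<and> ul \<noteq> ur)"

text \<open>
  The inviscid profile is unique up to translation, so the property of ``the'' profile is
  expressed by the existence of a profile having it.
\<close>

definition inviscid_sub_shock ::
  "(real \<Rightarrow> real) \<Rightarrow> (real \<Rightarrow> real) \<Rightarrow> real \<Rightarrow> real \<Rightarrow> real \<Rightarrow> bool"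
where
  "inviscid_sub_shock f g c um up \<longleftrightarrow>
     (\<exists>u v w xs. inviscid_profile f g c um up u v w xs \<and> jump_at u xs)"

end

theory Submission
  imports Defs "HOL-Probability.Distributions" "HOL-Complex_Analysis.Great_Picard"
begin

text \<open>
  Put \<open>a = up\<close>, \<open>b = um\<close> and \<open>F s = f s - c * s - (f um - c * um)\<close>. Integrating the travelling wave
  equations once, a front is a decreasing solution \<open>U\<close>, going from \<open>b\<close> to \<open>a\<close>, of
  \[
    \epsilon U' = F(U) - V, \qquad V = W', \qquad V' = W - g(U) ,
  \]
  where \<open>F\<close> vanishes at \<open>a\<close> and \<open>b\<close> and is negative between them, by convexity and the
  Rankine--Hugoniot relation. The bounded solution of \<open>W - W'' = g(U)\<close> is the convolution of \<open>g(U)\<close>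
  with \<open>exp (- \<bar>x\<bar>) / 2\<close>, so the second order form of the equation,
  \[
    \epsilon U'' - F(U)' - g(U) + W = 0 ,
  \]
  is a scalar viscous conservation law with a nonlocal relaxation term. Since \<open>g\<close> is increasing, it
  obeys a comparison principle, and that is what makes existence accessible for every positive
  \<open>\<epsilon>\<close>.

  The comparison principle takes the form of a monotone integral operator. Inverting
  \<open>\<epsilon> m\<^sup>2 - \<epsilon> d\<^sup>2/dx\<^sup>2\<close> turns the equation into a fixed-point equation \<open>U = T U\<close>, in which the derivative
  of \<open>F(U)\<close> is carried by the Green function. With \<open>A\<^sub>m\<close> and \<open>B\<^sub>m\<close> denoting the averages over the past
  and the future with exponential weights of rate \<open>m\<close>,
  \[
    T U = A_m\, p(U) + B_m\, q(U) + (A_m W + B_m W) / (2 \epsilon m^2) ,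
  \]
  where \<open>p\<close> and \<open>q\<close> are the combinations \<open>s / 2 - g s / (2 \<epsilon> m\<^sup>2) \<plusminus> F s / (2 \<epsilon> m)\<close>. Both are increasing
  on \<open>{a..b}\<close> once \<open>m\<close> is large. Then \<open>T\<close> is monotone, commutes with translations, and preserves the
  class of decreasing functions with values in \<open>{a..b}\<close> and Lipschitz constant \<open>m (b - a)\<close>. The
  constants between \<open>a\<close> and \<open>b\<close> are fixed points too, so the difficulty is to find a fixed point that
  really connects \<open>b\<close> to \<open>a\<close>.

  This is where conservation enters. The functional \<open>defect U\<close> is the error in the first order
  equation: \<open>\<epsilon> (T U)' = F(U) - V + defect U\<close> and \<open>(defect U)' = \<epsilon> m\<^sup>2 (T U - U)\<close>. For \<open>n > 0\<close>, clamp
  \<open>T U\<close> between two ramps, so that it becomes \<open>b\<close> to the left of \<open>- n - 1\<close> and \<open>a\<close> to the right of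
  \<open>n + 1\<close>. Monotone iteration gives a fixed point \<open>U\<close> of the clamped operator. Its defect tends to \<open>0\<close>
  at both ends, decreases on the left, is a constant \<open>- j \<le> 0\<close> on \<open>{- n..n}\<close>, and increases on the
  right. Integrating the first order equation over \<open>{- n..n}\<close> and using \<open>F \<le> 0\<close> bounds \<open>2 n j\<close>
  independently of \<open>n\<close> (\<open>truncated_defect_bound\<close>). Hence the defect is uniformly \<open>O(1 / n)\<close>.

  Now translate these functions so that each takes the value \<open>(a + b) / 2\<close> at \<open>0\<close>, and pass to a
  pointwise limit along a subsequence. The limit has defect \<open>0\<close>, whether or not the ramps escape to
  infinity, so it is a fixed point of \<open>T\<close> and solves the first order equation. Being monotone, it has
  limits at both ends, and there \<open>F\<close> must vanish; as \<open>F < 0\<close> strictly between \<open>a\<close> and \<open>b\<close> and \<open>U 0\<close> is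
  the midpoint, the limits are \<open>b\<close> and \<open>a\<close> (\<open>exists_front\<close>).
\<close>

section \<open>One-sided exponential averages\<close>

text \<open>
  The kernels \<open>m * exp (- m * \<bar>t\<bar>)\<close> on the two half lines are kept apart, and are written as
  expectations under the exponential distribution: bounded continuous functions are then integrable,
  and order, constants and bounded pointwise limits pass through the averages.
\<close>
definition exp_law :: "real \<Rightarrow> real measure" where
  "exp_law m = density lborel (exponential_density m)"

definition past_mean :: "real \<Rightarrow> (real \<Rightarrow> real) \<Rightarrow> real \<Rightarrow> real" where
  "past_mean m \<phi> x = (\<integral>t. \<phi> (x - t) \<partial>exp_law m)"

definition future_mean :: "real \<Rightarrow> (real \<Rightarrow> real) \<Rightarrow> real \<Rightarrow> real" where
  "future_mean m \<phi> x = (\<integral>t. \<phi> (x + t) \<partial>exp_law m)"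

lemma future_mean_reflect: "future_mean m \<phi> x = past_mean m (\<lambda>y. \<phi> (- y)) (- x)"
  by (simp add: future_mean_def past_mean_def add.commute)

lemma sets_exp_law [measurable_cong, simp]: "sets (exp_law m) = sets borel"
  by (simp add: exp_law_def)

lemma prob_space_exp_law: "m > 0 \<Longrightarrow> prob_space (exp_law m)"
  unfolding exp_law_def by (rule prob_space_exponential_density)

lemma bcontfun_measurable: "\<phi> \<in> bcontfun \<Longrightarrow> (\<phi> :: real \<Rightarrow> real) \<in> borel_measurable borel"
  by (auto simp: bcontfun_def intro: borel_measurable_continuous_onI)

lemma bcontfun_comp:
  assumes "(\<phi> :: real \<Rightarrow> real) \<in> bcontfun" "continuous_on UNIV h"
  shows "(\<lambda>t. \<phi> (h t)) \<in> bcontfun"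
proof -
  have "continuous_on UNIV (\<lambda>t. \<phi> (h t))"
    using assms by (auto simp: bcontfun_def intro: continuous_on_compose2[of UNIV \<phi>])
  moreover have "bounded (range (\<lambda>t. \<phi> (h t)))"
    using assms(1) unfolding bcontfun_def by (auto elim!: bounded_subset)
  ultimately show ?thesis by (simp add: bcontfun_def)
qed

lemma bcontfun_shift:
  assumes "(\<phi> :: real \<Rightarrow> real) \<in> bcontfun"
  shows "(\<lambda>t. \<phi> (x - t)) \<in> bcontfun" "(\<lambda>t. \<phi> (x + t)) \<in> bcontfun" "(\<lambda>t. \<phi> (- t)) \<in> bcontfun"
  by (auto intro!: bcontfun_comp[OF assms] continuous_intros)

lemma integrable_exp_law:
  assumes "m > 0" "(\<phi> :: real \<Rightarrow> real) \<in> bcontfun"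
  shows "integrable (exp_law m) \<phi>"
proof -
  interpret prob_space "exp_law m" using assms(1) by (rule prob_space_exp_law)
  obtain B where "\<And>x. norm (\<phi> x) \<le> B"
    using assms(2) by (auto simp: bcontfun_def bounded_iff)
  moreover have "\<phi> \<in> borel_measurable (exp_law m)"
    using bcontfun_measurable[OF assms(2)] by simp
  ultimately show ?thesis by (intro integrable_const_bound[of _ B]) auto
qed

lemmas integrable_means =
  integrable_exp_law[OF _ bcontfun_shift(1)] integrable_exp_law[OF _ bcontfun_shift(2)]

lemma means_mono:
  assumes "m > 0" "\<phi> \<in> bcontfun" "\<psi> \<in> bcontfun" "\<And>y. \<phi> y \<le> \<psi> y"
  shows "past_mean m \<phi> x \<le> past_mean m \<psi> x" "future_mean m \<phi> x \<le> future_mean m \<psi> x"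
  unfolding past_mean_def future_mean_def
  using assms by (auto intro!: integral_mono integrable_means)

lemma means_antimono:
  assumes "m > 0" "\<phi> \<in> bcontfun" "antimono \<phi>"
  shows "antimono (past_mean m \<phi>)" "antimono (future_mean m \<phi>)"
proof -
  have "\<phi> y \<le> \<phi> x" if "x \<le> y" for x y
    using antimonoD[OF assms(3) that] .
  then show "antimono (past_mean m \<phi>)" "antimono (future_mean m \<phi>)"
    unfolding past_mean_def future_mean_def antimono_def using assms(1,2)
    by (auto intro!: integral_mono integrable_means)
qed

lemma means_bounds:
  assumes "m > 0" "\<phi> \<in> bcontfun" "\<And>y. \<phi> y \<in> {p..q}"
  shows "past_mean m \<phi> x \<in> {p..q}" "future_mean m \<phi> x \<in> {p..q}"
proof -
  interpret prob_space "exp_law m" using assms(1) by (rule prob_space_exp_law)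
  have const: "past_mean m (\<lambda>_. k) x = k" "future_mean m (\<lambda>_. k) x = k" for k
    by (simp_all add: past_mean_def future_mean_def prob_space)
  have c: "(\<lambda>_. k) \<in> bcontfun" for k :: real by (simp add: bcontfun_def)
  show "past_mean m \<phi> x \<in> {p..q}" "future_mean m \<phi> x \<in> {p..q}"
    using means_mono[OF assms(1,2) c, of q x] means_mono[OF assms(1) c assms(2), of p x] assms(3)
    by (auto simp: const)
qed

lemma means_dominated_convergence:
  assumes "m > 0" "\<And>n. \<phi> n \<in> bcontfun" "\<psi> \<in> bcontfun" "\<And>n y. \<bar>\<phi> n y\<bar> \<le> B"
    and "\<And>y. (\<lambda>n. \<phi> n y) \<longlonglongrightarrow> \<psi> y"
  shows "(\<lambda>n. past_mean m (\<phi> n) x) \<longlonglongrightarrow> past_mean m \<psi> x"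
    "(\<lambda>n. future_mean m (\<phi> n) x) \<longlonglongrightarrow> future_mean m \<psi> x"
proof -
  interpret prob_space "exp_law m" using assms(1) by (rule prob_space_exp_law)
  show "(\<lambda>n. past_mean m (\<phi> n) x) \<longlonglongrightarrow> past_mean m \<psi> x"
    "(\<lambda>n. future_mean m (\<phi> n) x) \<longlonglongrightarrow> future_mean m \<psi> x"
    unfolding past_mean_def future_mean_def
    using assms(4,5) borel_measurable_integrable[OF integrable_means(1)[OF assms(1,2)]]
      borel_measurable_integrable[OF integrable_means(1)[OF assms(1,3)]]
      borel_measurable_integrable[OF integrable_means(2)[OF assms(1,2)]]
      borel_measurable_integrable[OF integrable_means(2)[OF assms(1,3)]]
    by (auto intro!: integral_dominated_convergence[where w = "\<lambda>_. B"])
qed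

lemma past_mean_at_top:
  assumes "m > 0" "\<phi> \<in> bcontfun" "(\<phi> \<longlongrightarrow> l) at_top"
  shows "(past_mean m \<phi> \<longlongrightarrow> l) at_top"
proof -
  interpret prob_space "exp_law m" using assms(1) by (rule prob_space_exp_law)
  obtain B where B: "\<And>x. norm (\<phi> x) \<le> B"
    using assms(2) by (auto simp: bcontfun_def bounded_iff)
  have "((\<lambda>x. \<integral>t. \<phi> (x - t) \<partial>exp_law m) \<longlongrightarrow> (\<integral>t. l \<partial>exp_law m)) at_top"
  proof (rule integral_dominated_convergence_at_top[where w = "\<lambda>_. B"])
    have "((\<lambda>x. \<phi> (x - t)) \<longlongrightarrow> l) at_top" for t
      by (rule filterlim_compose[OF assms(3)])
        (use filterlim_tendsto_add_at_top[OF tendsto_const filterlim_ident, of "- t"] in simp)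
    then show "AE t in exp_law m. ((\<lambda>x. \<phi> (x - t)) \<longlongrightarrow> l) at_top" by simp
  qed (use B assms integrable_means(1)[OF assms(1,2)] in \<open>auto intro: borel_measurable_integrable\<close>)
  then show ?thesis by (simp add: past_mean_def[abs_def] prob_space)
qed

lemma past_mean_at_bot:
  assumes "m > 0" "\<phi> \<in> bcontfun" "(\<phi> \<longlongrightarrow> l) at_bot"
  shows "(past_mean m \<phi> \<longlongrightarrow> l) at_bot"
proof -
  interpret prob_space "exp_law m" using assms(1) by (rule prob_space_exp_law)
  obtain B where B: "\<And>x. norm (\<phi> x) \<le> B"
    using assms(2) by (auto simp: bcontfun_def bounded_iff)
  have "((\<lambda>x. \<integral>t. \<phi> (- x - t) \<partial>exp_law m) \<longlongrightarrow> (\<integral>t. l \<partial>exp_law m)) at_top"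
  proof (rule integral_dominated_convergence_at_top[where w = "\<lambda>_. B"])
    have "((\<lambda>x. \<phi> (- x - t)) \<longlongrightarrow> l) at_top" for t
    proof (rule filterlim_compose[OF assms(3)])
      have "LIM x at_top. t + x :> at_top"
        by (rule filterlim_tendsto_add_at_top[OF tendsto_const filterlim_ident])
      then have "LIM x at_top. - (t + x) :> at_bot"
        by (rule filterlim_compose[OF filterlim_uminus_at_bot_at_top])
      then show "LIM x at_top. - x - t :> at_bot" by (simp add: algebra_simps)
    qed
    then show "AE t in exp_law m. ((\<lambda>x. \<phi> (- x - t)) \<longlongrightarrow> l) at_top" by simp
  qed (use B assms integrable_means(1)[OF assms(1,2)] in \<open>auto intro: borel_measurable_integrable\<close>)
  then show ?thesis by (simp add: past_mean_def[abs_def] prob_space filterlim_at_bot_mirror)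
qed

lemma future_mean_at_top:
  assumes "m > 0" "\<phi> \<in> bcontfun" "(\<phi> \<longlongrightarrow> l) at_top"
  shows "(future_mean m \<phi> \<longlongrightarrow> l) at_top"
  using past_mean_at_bot[OF assms(1) bcontfun_shift(3)[OF assms(2)], of l] assms(3)
  by (simp add: filterlim_at_bot_mirror future_mean_reflect[abs_def])

lemma future_mean_at_bot:
  assumes "m > 0" "\<phi> \<in> bcontfun" "(\<phi> \<longlongrightarrow> l) at_bot"
  shows "(future_mean m \<phi> \<longlongrightarrow> l) at_bot"
  using past_mean_at_top[OF assms(1) bcontfun_shift(3)[OF assms(2)], of l] assms(3)
  by (simp add: filterlim_at_bot_mirror future_mean_reflect[abs_def])

text \<open>
  The two ends of the line are treated together by letting the filter range over
  \<open>{at_top, at_bot}\<close>.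
\<close>
lemma means_tendsto_at_ends:
  assumes "E \<in> {at_top, at_bot}" "m > 0" "\<phi> \<in> bcontfun" "(\<phi> \<longlongrightarrow> l) E"
  shows "(past_mean m \<phi> \<longlongrightarrow> l) E" "(future_mean m \<phi> \<longlongrightarrow> l) E"
  using assms past_mean_at_top[OF assms(2,3)] past_mean_at_bot[OF assms(2,3)]
    future_mean_at_top[OF assms(2,3)] future_mean_at_bot[OF assms(2,3)] by auto

lemma has_real_derivative_integral_atMost:
  fixes h :: "real \<Rightarrow> real"
  assumes "continuous_on UNIV h" "\<And>x. set_integrable lborel {..x} h"
  shows "((\<lambda>x. LBINT y:{..x}. h y) has_real_derivative h x) (at x)"
proof -
  have eq: "(LBINT y:{..z}. h y) = (LBINT y:{..x - 1}. h y) + integral {x - 1..z} h"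
    if "z \<in> {x - 1..x + 1}" for z
  proof -
    have i: "set_integrable lborel {x - 1<..z} h"
      by (rule set_integrable_subset[OF assms(2)[of z]]) auto
    have "{..z} = {..x - 1} \<union> {x - 1<..z}" using that by auto
    then have "(LBINT y:{..z}. h y) = (LBINT y:{..x - 1}. h y) + (LBINT y:{x - 1<..z}. h y)"
      using i assms(2) by (simp add: set_integral_Un ivl_disj_int)
    also have "(LBINT y:{x - 1<..z}. h y) = integral {x - 1<..z} h"
      using i by (rule set_borel_integral_eq_integral)
    also have "\<dots> = integral {x - 1..z} h"
      by (rule integral_subset_negligible[symmetric, THEN sym])
         (auto intro: negligible_subset[of "{x - 1}"])
    finally show ?thesis .
  qed
  have "((\<lambda>z. integral {x - 1..z} h) has_real_derivative h x) (at x within {x - 1..x + 1})"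
    by (rule integral_has_real_derivative) (auto intro: continuous_on_subset[OF assms(1)])
  then have "((\<lambda>z. integral {x - 1..z} h) has_real_derivative h x) (at x)"
    by (simp only: at_within_Icc_at[of "x - 1" x "x + 1", simplified])
  then have "((\<lambda>z. (LBINT y:{..x - 1}. h y) + integral {x - 1..z} h) has_real_derivative h x) (at x)"
    using DERIV_add[OF DERIV_const, of "\<lambda>z. integral {x - 1..z} h" "h x" x UNIV] by simp
  then show ?thesis
  proof (rule has_field_derivative_transform_within[where d = 1])
    fix z assume "dist z x < 1"
    then have "z \<in> {x - 1..x + 1}" by (auto simp: dist_real_def abs_if split: if_splits)
    then show "(LBINT y:{..x - 1}. h y) + integral {x - 1..z} h = (LBINT y:{..z}. h y)"
      by (rule eq[symmetric])
  qed simp_all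
qed

text \<open>
  Substituting \<open>y = x - t\<close> isolates the dependence on \<open>x\<close> in an elementary factor and in the upper end
  of an integral, so that the fundamental theorem of calculus applies.
\<close>
lemma past_mean_integrals:
  assumes "m > 0" "\<phi> \<in> bcontfun"
  shows "set_integrable lborel {..x} (\<lambda>y. m * exp (m * y) * \<phi> y)"
    and "past_mean m \<phi> x = exp (- m * x) * (LBINT y:{..x}. m * exp (m * y) * \<phi> y)"
proof -
  let ?d = "exponential_density m"
  have "integrable lborel (\<lambda>t. ?d t * \<phi> (x - t))"
    using integrable_means(1)[OF assms, of x]
      bcontfun_measurable[OF bcontfun_shift(1)[OF assms(2)], of x]
    unfolding exp_law_def using assms
    by (subst (asm) integrable_real_density) (auto simp: exponential_density_nonneg)
  then have "integrable lborel (\<lambda>y. ?d (x - y) * \<phi> y)"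
    using lborel_integrable_real_affine[of "\<lambda>t. ?d t * \<phi> (x - t)" "-1" x] by simp
  then have "integrable lborel (\<lambda>y. exp (m * x) * (?d (x - y) * \<phi> y))" by simp
  also have "(\<lambda>y. exp (m * x) * (?d (x - y) * \<phi> y)) =
      (\<lambda>y. indicator {..x} y *\<^sub>R (m * exp (m * y) * \<phi> y))"
    by (auto simp: fun_eq_iff exponential_density_def indicator_def left_diff_distrib exp_diff
        mult.commute[of m])
  finally show "set_integrable lborel {..x} (\<lambda>y. m * exp (m * y) * \<phi> y)"
    by (simp add: set_integrable_def)
  have "past_mean m \<phi> x = (\<integral>t. ?d t * \<phi> (x - t) \<partial>lborel)"
    using bcontfun_measurable[OF bcontfun_shift(1)[OF assms(2)], of x] assms
    unfolding exp_law_def past_mean_def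
    by (subst integral_real_density) (auto simp: exponential_density_nonneg)
  also have "\<dots> = (\<integral>y. ?d (x - y) * \<phi> y \<partial>lborel)"
    using lborel_integral_real_affine[of "-1" "\<lambda>t. ?d t * \<phi> (x - t)" x] by simp
  also have "\<dots> = (\<integral>y. exp (- m * x) * (indicator {..x} y *\<^sub>R (m * exp (m * y) * \<phi> y)) \<partial>lborel)"
    by (intro Bochner_Integration.integral_cong)
      (auto simp: exponential_density_def indicator_def exp_diff exp_minus field_simps)
  finally show "past_mean m \<phi> x = exp (- m * x) * (LBINT y:{..x}. m * exp (m * y) * \<phi> y)"
    by (simp add: set_lebesgue_integral_def)
qed

lemma has_real_derivative_past_mean:
  assumes "m > 0" "\<phi> \<in> bcontfun"
  shows "(past_mean m \<phi> has_real_derivative m * (\<phi> x - past_mean m \<phi> x)) (at x)"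
proof -
  let ?h = "\<lambda>y. m * exp (m * y) * \<phi> y"
  have "continuous_on UNIV ?h"
    using assms(2) by (auto simp: bcontfun_def intro!: continuous_intros)
  from has_real_derivative_integral_atMost[OF this past_mean_integrals(1)[OF assms]]
  have d: "((\<lambda>x. LBINT y:{..x}. ?h y) has_real_derivative ?h x) (at x)" .
  have e: "past_mean m \<phi> = (\<lambda>x. exp (- m * x) * (LBINT y:{..x}. ?h y))"
    using past_mean_integrals(2)[OF assms] by blast
  have "((\<lambda>x. exp (- m * x) * (LBINT y:{..x}. ?h y)) has_real_derivative
      exp (- m * x) * ?h x + exp (- m * x) * (- m) * (LBINT y:{..x}. ?h y)) (at x)"
    by (rule DERIV_mult'[OF _ d]) (auto intro!: derivative_eq_intros)
  moreover have "exp (- m * x) * ?h x = m * \<phi> x" by (simp add: exp_minus)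
  moreover have "m * (\<phi> x - past_mean m \<phi> x) =
      m * \<phi> x + exp (- m * x) * (- m) * (LBINT y:{..x}. ?h y)"
    unfolding past_mean_integrals(2)[OF assms, of x] by (simp only: right_diff_distrib) simp
  ultimately show ?thesis unfolding e[symmetric] by (simp only:)
qed

lemma has_real_derivative_future_mean:
  assumes "m > 0" "\<phi> \<in> bcontfun"
  shows "(future_mean m \<phi> has_real_derivative m * (future_mean m \<phi> x - \<phi> x)) (at x)"
proof -
  have "((\<lambda>x. past_mean m (\<lambda>y. \<phi> (- y)) (- x)) has_real_derivative
      m * (\<phi> x - past_mean m (\<lambda>y. \<phi> (- y)) (- x)) * (- 1)) (at x)"
    using has_real_derivative_past_mean[OF assms(1) bcontfun_shift(3)[OF assms(2)], of "- x"]
    by (intro DERIV_chain2[where g = uminus]) (auto intro!: derivative_eq_intros)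
  then show ?thesis by (simp add: future_mean_reflect[abs_def] algebra_simps)
qed

lemma bcontfunI_range:
  assumes "continuous_on UNIV (\<phi> :: real \<Rightarrow> real)" "\<And>x. \<phi> x \<in> {p..q}"
  shows "\<phi> \<in> bcontfun"
proof -
  have "range \<phi> \<subseteq> {p..q}" using assms(2) by blast
  then show ?thesis
    using assms(1) bounded_subset[OF bounded_closed_interval] by (auto simp: bcontfun_def)
qed

section \<open>Real functions: compactness, limits and monotonicity\<close>

text \<open>
  A diagonal argument gives convergence at the rational points; the common Lipschitz constant
  carries it to every point.
\<close>
lemma equi_lipschitz_convergent_subsequence:
  fixes X :: "nat \<Rightarrow> real \<Rightarrow> real"
  assumes "\<And>n x. \<bar>X n x\<bar> \<le> B" and "\<And>n. L-lipschitz_on UNIV (X n)"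
  obtains k U where "strict_mono (k :: nat \<Rightarrow> nat)" "\<And>x. (\<lambda>n. X (k n) x) \<longlonglongrightarrow> U x"
proof -
  obtain k where k: "strict_mono k" "\<And>x. x \<in> \<rat> \<Longrightarrow> \<exists>l. (\<lambda>n. X (k n) x) \<longlonglongrightarrow> l"
    using function_convergent_subsequence[OF countable_rat, of X B] assms(1) by auto
  have L: "L \<ge> 0" using assms(2) by (rule lipschitz_on_nonneg)
  have "Cauchy (\<lambda>n. X (k n) x)" for x
  proof (rule metric_CauchyI)
    fix e :: real assume e: "e > 0"
    define d where "d = e / 3 / (L + 1)"
    have d: "d > 0" using e L by (simp add: d_def)
    then obtain r where r: "r \<in> \<rat>" "x < r" "r < x + d"
      using Rats_dense_in_real[of x "x + d"] by auto
    have "L + 1 \<noteq> 0" using L by simp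
    from nonzero_eq_divide_eq[OF this, of d "e / 3"] have "d * (L + 1) = e / 3"
      using d_def by blast
    moreover have "L * d \<le> d * (L + 1)" using d by (simp add: distrib_left)
    ultimately have Ld: "L * d \<le> e / 3" by simp
    have near: "dist (X n x) (X n r) \<le> e / 3" for n
    proof -
      have "dist (X n x) (X n r) \<le> L * dist x r" using assms(2) by (rule lipschitz_onD) auto
      also have "\<dots> \<le> L * d" using r L by (intro mult_left_mono) (auto simp: dist_real_def)
      finally show ?thesis using Ld by simp
    qed
    have C: "Cauchy (\<lambda>n. X (k n) r)"
      using k(2)[OF r(1)] by (auto intro: LIMSEQ_imp_Cauchy)
    have "e / 3 > 0" using e by simp
    from metric_CauchyD[OF C this]
    obtain M where M: "\<And>i j. i \<ge> M \<Longrightarrow> j \<ge> M \<Longrightarrow> dist (X (k i) r) (X (k j) r) < e / 3"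
      by blast
    have "dist (X (k i) x) (X (k j) x) < e" if "i \<ge> M" "j \<ge> M" for i j
      using near[of "k i"] near[of "k j"] M[OF that] unfolding dist_real_def by linarith
    then show "\<exists>M. \<forall>i\<ge>M. \<forall>j\<ge>M. dist (X (k i) x) (X (k j) x) < e" by blast
  qed
  then have "\<forall>x. \<exists>l. (\<lambda>n. X (k n) x) \<longlonglongrightarrow> l"
    by (auto simp: Cauchy_convergent_iff convergent_def)
  then obtain U where "\<And>x. (\<lambda>n. X (k n) x) \<longlonglongrightarrow> U x" by metis
  with k(1) show ?thesis by (rule that)
qed

lemma antimono_tendsto_at_top:
  fixes U :: "real \<Rightarrow> real"
  assumes "antimono U" "\<And>x. U x \<ge> c"
  shows "\<exists>l. (U \<longlongrightarrow> l) at_top \<and> (\<forall>x. l \<le> U x)"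
proof (intro exI conjI allI)
  let ?l = "INF x. U x"
  have bdd: "bdd_below (range U)" using assms(2) by (auto intro!: bdd_belowI[of _ c])
  show le: "?l \<le> U x" for x by (rule cINF_lower[OF bdd]) simp
  show "(U \<longlongrightarrow> ?l) at_top"
  proof (rule order_tendstoI)
    fix y assume "y < ?l"
    with le show "\<forall>\<^sub>F x in at_top. y < U x" by (intro always_eventually) (auto intro: less_le_trans)
  next
    fix y assume "?l < y"
    then obtain x where "U x < y" using cINF_less_iff[OF _ bdd, of y] by auto
    then have "U z < y" if "z \<ge> x" for z using antimonoD[OF assms(1) that] by simp
    then show "\<forall>\<^sub>F x in at_top. U x < y" by (auto simp: eventually_at_top_linorder)
  qed
qed

text \<open>
  By the mean value theorem the derivative takes the values \<open>U (x + 1) - U x\<close> arbitrarily far out, and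
  these tend to \<open>0\<close>.
\<close>
lemma tendsto_derivative_eq_0:
  fixes U :: "real \<Rightarrow> real"
  assumes "\<And>x. (U has_real_derivative U' x) (at x)" "(U \<longlongrightarrow> l) at_top" "(U' \<longlongrightarrow> k) at_top"
  shows "k = 0"
proof -
  have "\<exists>z>x. z < x + 1 \<and> U (x + 1) - U x = U' z" for x
    using MVT2[of x "x + 1" U U'] assms(1) by auto
  then obtain z where z: "\<And>x. z x > x" "\<And>x. U (x + 1) - U x = U' (z x)" by metis
  have shift: "LIM x at_top. x + 1 :> (at_top :: real filter)"
    using filterlim_tendsto_add_at_top[OF tendsto_const filterlim_ident, of 1] by (simp add: add.commute)
  have "LIM x at_top. z x :> at_top"
    by (rule filterlim_at_top_mono[OF filterlim_ident]) (auto intro!: always_eventually less_imp_le z)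
  then have "((\<lambda>x. U (x + 1) - U x) \<longlongrightarrow> k) at_top"
    using filterlim_compose[OF assms(3)] by (simp add: z(2))
  moreover have "((\<lambda>x. U (x + 1) - U x) \<longlongrightarrow> l - l) at_top"
    by (intro tendsto_diff assms(2) filterlim_compose[OF assms(2) shift])
  ultimately have "k = l - l" by (rule tendsto_unique[OF trivial_limit_at_top_linorder])
  then show ?thesis by simp
qed

lemma mono_on_of_derivative_nonneg:
  fixes h :: "real \<Rightarrow> real"
  assumes "\<And>s. s \<in> {a..b} \<Longrightarrow> (h has_real_derivative h' s) (at s)" "\<And>s. s \<in> {a..b} \<Longrightarrow> h' s \<ge> 0"
  shows "mono_on {a..b} h"
proof (rule mono_onI)
  fix x y assume xy: "x \<in> {a..b}" "y \<in> {a..b}" "x \<le> y"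
  show "h x \<le> h y"
  proof (rule DERIV_nonneg_imp_nondecreasing[OF xy(3), where f = h])
    fix z assume "x \<le> z" "z \<le> y"
    with xy have "z \<in> {a..b}" by simp
    with assms show "\<exists>d. (h has_real_derivative d) (at z) \<and> d \<ge> 0" by blast
  qed
qed

text \<open>
  A nonnegative value in between would force the increasing derivative to be first nonnegative and
  later nonpositive.
\<close>
lemma negative_between_zeros:
  fixes F F' :: "real \<Rightarrow> real"
  assumes "\<And>s. (F has_real_derivative F' s) (at s)" "strict_mono F'" "F a = 0" "F b = 0" "a < s" "s < b"
  shows "F s < 0"
proof (rule ccontr)
  assume "\<not> F s < 0"
  obtain y where y: "a < y" "y < s" "F s - F a = (s - a) * F' y"
    using MVT2[of a s F F'] assms by blast
  obtain z where z: "s < z" "z < b" "F b - F s = (b - s) * F' z"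
    using MVT2[of s b F F'] assms by blast
  have "(s - a) * F' y \<ge> 0" "(b - s) * F' z \<le> 0"
    using \<open>\<not> F s < 0\<close> assms(3,4) by (simp_all add: y(3)[symmetric] z(3)[symmetric])
  then have "F' y \<ge> 0" "F' z \<le> 0"
    using assms(5,6) by (simp_all add: zero_le_mult_iff mult_le_0_iff)
  moreover have "F' y < F' z" using y z assms(2) by (auto simp: strict_mono_def)
  ultimately show False by simp
qed

section \<open>The monotone fixed-point problem\<close>

text \<open>
  The last two assumptions express that \<open>m\<close> is large: they are what makes the operator \<open>T\<close> below
  monotone. The bound \<open>m \<ge> 1\<close> makes ramps of unit width admissible profiles.
\<close>
locale viscous_front_problem =
  fixes F g :: "real \<Rightarrow> real" and a b \<epsilon> m :: real
  assumes a_less_b: "a < b" and eps_pos: "\<epsilon> > 0" and m_ge_1: "m \<ge> 1"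
    and continuous_F: "continuous_on {a..b} F" and continuous_g: "continuous_on {a..b} g"
    and mono_g: "mono_on {a..b} g"
    and F_a: "F a = 0" and F_b: "F b = 0" and F_neg: "\<And>s. a < s \<Longrightarrow> s < b \<Longrightarrow> F s < 0"
    and mono_p': "mono_on {a..b} (\<lambda>s. s / 2 - g s / (2 * (\<epsilon> * m\<^sup>2)) + F s / (2 * \<epsilon> * m))"
    and mono_q': "mono_on {a..b} (\<lambda>s. s / 2 - g s / (2 * (\<epsilon> * m\<^sup>2)) - F s / (2 * \<epsilon> * m))"
begin

text \<open>
  The zeroth order coefficient in the operator \<open>rate - \<epsilon> d\<^sup>2/dx\<^sup>2\<close>, whose Green function is the two-sided
  exponential with exponent \<open>m\<close>.
\<close>
definition rate :: real where "rate = \<epsilon> * m\<^sup>2"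

text \<open>
  Convolving \<open>rate * U - g(U)\<close> with the Green function, and \<open>F(U)\<close> with its derivative, which is odd,
  gives the two half lines the same contribution from the former and opposite ones from the latter.
  Collecting the terms by half line gives \<open>p\<close> for the past and \<open>q\<close> for the future.
\<close>
definition p :: "real \<Rightarrow> real" where "p s = s / 2 - g s / (2 * rate) + F s / (2 * \<epsilon> * m)"

definition q :: "real \<Rightarrow> real" where "q s = s / 2 - g s / (2 * rate) - F s / (2 * \<epsilon> * m)"

text \<open>
  The bounded solution of \<open>W - W'' = g(U)\<close>; \<open>V\<close> is its derivative.
\<close>
definition W :: "(real \<Rightarrow> real) \<Rightarrow> real \<Rightarrow> real" where
  "W U x = (past_mean 1 (\<lambda>y. g (U y)) x + future_mean 1 (\<lambda>y. g (U y)) x) / 2"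

definition V :: "(real \<Rightarrow> real) \<Rightarrow> real \<Rightarrow> real" where
  "V U x = (future_mean 1 (\<lambda>y. g (U y)) x - past_mean 1 (\<lambda>y. g (U y)) x) / 2"

text \<open>
  The inverse of \<open>rate - \<epsilon> d\<^sup>2/dx\<^sup>2\<close> applied to \<open>rate * U - F(U)' - g(U) + W\<close>.
\<close>
definition T :: "(real \<Rightarrow> real) \<Rightarrow> real \<Rightarrow> real" where
  "T U x = past_mean m (\<lambda>y. p (U y)) x + future_mean m (\<lambda>y. q (U y)) x
     + (past_mean m (W U) x + future_mean m (W U) x) / (2 * rate)"

text \<open>
  The residual \<open>\<epsilon> (T U)' - F(U) + V\<close> of the first order front equation, in a form that mentions \<open>U\<close> only
  under averages: it is differentiable even where only continuity of \<open>U\<close> is known, and it is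
  continuous under pointwise limits.
\<close>
definition defect :: "(real \<Rightarrow> real) \<Rightarrow> real \<Rightarrow> real" where
  "defect U x = \<epsilon> * m * (future_mean m (\<lambda>y. q (U y)) x - past_mean m (\<lambda>y. p (U y)) x)
     + (future_mean m (W U) x - past_mean m (W U) x) / (2 * m) + V U x"

definition profiles :: "(real \<Rightarrow> real) set" where
  "profiles = {U. antimono U \<and> (\<forall>x. U x \<in> {a..b}) \<and> (m * (b - a))-lipschitz_on UNIV U}"

lemma m_pos: "m > 0" using m_ge_1 by simp

lemma rate_pos: "rate > 0" using eps_pos m_pos by (simp add: rate_def)

lemma mono_p: "mono_on {a..b} p" and mono_q: "mono_on {a..b} q"
  using mono_p' mono_q' by (simp_all add: p_def q_def rate_def monotone_on_def)

lemma continuous_p: "continuous_on {a..b} p" and continuous_q: "continuous_on {a..b} q"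
  unfolding p_def q_def
  by (auto intro!: continuous_intros continuous_F continuous_g simp: eps_pos m_pos rate_pos less_imp_neq[symmetric])

lemma profilesD:
  assumes "U \<in> profiles"
  shows "antimono U" "U x \<in> {a..b}" "(m * (b - a))-lipschitz_on UNIV U" "continuous_on UNIV U"
    "x \<le> y \<Longrightarrow> U y \<le> U x"
  using assms by (auto simp: profiles_def antimono_def intro: lipschitz_on_continuous_on)

lemma bcontfun_comp_profile:
  assumes "U \<in> profiles" "continuous_on {a..b} h"
  shows "(\<lambda>x. h (U x)) \<in> bcontfun"
proof -
  have "range U \<subseteq> {a..b}" using profilesD(2)[OF assms(1)] by blast
  then have "range (\<lambda>x. h (U x)) \<subseteq> h ` {a..b}" by blast
  moreover have "bounded (h ` {a..b})"
    by (intro compact_imp_bounded compact_continuous_image assms compact_Icc)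
  moreover have "continuous_on UNIV (\<lambda>x. h (U x))"
    by (rule continuous_on_compose2[OF assms(2) profilesD(4)[OF assms(1)] \<open>range U \<subseteq> {a..b}\<close>])
  ultimately show ?thesis by (auto simp: bcontfun_def intro: bounded_subset)
qed

lemma comp_profile_bounds:
  assumes "U \<in> profiles" "mono_on {a..b} h"
  shows "h (U x) \<in> {h a..h b}"
  using profilesD(2)[OF assms(1), of x] assms(2) a_less_b by (auto simp: mono_on_def)

lemma antimono_comp_profile:
  assumes "U \<in> profiles" "mono_on {a..b} h"
  shows "antimono (\<lambda>x. h (U x))"
  using profilesD(2,5)[OF assms(1)] assms(2) by (auto simp: antimono_def mono_on_def)

lemmas bcontfun_g_profile = bcontfun_comp_profile[OF _ continuous_g]
lemmas bcontfun_p_profile = bcontfun_comp_profile[OF _ continuous_p]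
lemmas bcontfun_q_profile = bcontfun_comp_profile[OF _ continuous_q]

lemma W_has_derivative:
  assumes "U \<in> profiles"
  shows "(W U has_real_derivative V U x) (at x)"
  unfolding W_def[abs_def] V_def
  by (rule derivative_eq_intros has_real_derivative_past_mean has_real_derivative_future_mean
      bcontfun_g_profile[OF assms] refl | simp add: field_simps)+

lemma V_has_derivative:
  assumes "U \<in> profiles"
  shows "(V U has_real_derivative W U x - g (U x)) (at x)"
  unfolding W_def V_def[abs_def]
  by (rule derivative_eq_intros has_real_derivative_past_mean has_real_derivative_future_mean
      bcontfun_g_profile[OF assms] refl | simp add: field_simps)+

lemma W_bounds:
  assumes "U \<in> profiles"
  shows "W U x \<in> {g a..g b}"
  using means_bounds[of 1, OF _ bcontfun_g_profile[OF assms] comp_profile_bounds[OF assms mono_g], of x]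
  by (simp add: W_def)

lemma W_bcontfun:
  assumes "U \<in> profiles"
  shows "W U \<in> bcontfun"
  by (rule bcontfunI_range[OF _ W_bounds[OF assms]])
    (auto intro!: continuous_at_imp_continuous_on DERIV_isCont W_has_derivative assms)

lemma W_mono:
  assumes "U \<in> profiles" "U' \<in> profiles" "\<And>x. U x \<le> U' x"
  shows "W U x \<le> W U' x"
proof -
  have "g (U y) \<le> g (U' y)" for y
    using mono_g assms profilesD(2)[OF assms(1)] profilesD(2)[OF assms(2)] by (auto simp: mono_on_def)
  from means_mono[of 1, OF _ bcontfun_g_profile[OF assms(1)] bcontfun_g_profile[OF assms(2)] this, of x] show ?thesis
    by (simp add: W_def)
qed

lemma W_antimono:
  assumes "U \<in> profiles"
  shows "antimono (W U)"
  using means_antimono[of 1, OF _ bcontfun_g_profile[OF assms] antimono_comp_profile[OF assms mono_g]]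
  by (auto simp: W_def antimono_def intro!: add_mono)

text \<open>
  The local terms combine because \<open>m * (p s - q s) = F s / \<epsilon>\<close>, while the two local copies of \<open>W\<close>
  cancel.
\<close>
lemma T_has_derivative:
  assumes "U \<in> profiles"
  shows "(T U has_real_derivative (F (U x) - V U x + defect U x) / \<epsilon>) (at x)"
proof -
  let ?P = "past_mean m (\<lambda>y. p (U y)) x" and ?Q = "future_mean m (\<lambda>y. q (U y)) x"
  let ?A = "past_mean m (W U) x" and ?B = "future_mean m (W U) x"
  have "(T U has_real_derivative
      m * (p (U x) - ?P) + m * (?Q - q (U x)) + (m * (W U x - ?A) + m * (?B - W U x)) / (2 * rate)) (at x)"
    unfolding T_def[abs_def]
    by (intro DERIV_add DERIV_cdivide has_real_derivative_past_mean has_real_derivative_future_mean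
      m_pos bcontfun_p_profile[OF assms] bcontfun_q_profile[OF assms] W_bcontfun[OF assms])
  moreover have "m * (p (U x) - ?P) + m * (?Q - q (U x)) +
      (m * (W U x - ?A) + m * (?B - W U x)) / (2 * rate) = (F (U x) - V U x + defect U x) / \<epsilon>"
    using m_pos eps_pos by (simp add: defect_def p_def q_def rate_def field_simps power2_eq_square)
  ultimately show ?thesis by simp
qed

text \<open>
  The differentiated form of the conservation law: an imbalance between \<open>T U\<close> and \<open>U\<close> is exactly a
  change of the residual flux. Here the local terms combine because \<open>p s + q s = s - g s / rate\<close>.
\<close>
lemma defect_has_derivative:
  assumes "U \<in> profiles"
  shows "(defect U has_real_derivative rate * (T U x - U x)) (at x)"
proof -
  let ?P = "past_mean m (\<lambda>y. p (U y)) x" and ?Q = "future_mean m (\<lambda>y. q (U y)) x"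
  let ?A = "past_mean m (W U) x" and ?B = "future_mean m (W U) x"
  have "(defect U has_real_derivative
      \<epsilon> * m * (m * (?Q - q (U x)) - m * (p (U x) - ?P))
      + (m * (?B - W U x) - m * (W U x - ?A)) / (2 * m) + (W U x - g (U x))) (at x)"
    unfolding defect_def[abs_def]
    by (intro DERIV_add DERIV_diff DERIV_cmult DERIV_cdivide has_real_derivative_past_mean
      has_real_derivative_future_mean V_has_derivative
      m_pos bcontfun_p_profile[OF assms] bcontfun_q_profile[OF assms] W_bcontfun[OF assms] assms)
  moreover have "\<epsilon> * m * (m * (?Q - q (U x)) - m * (p (U x) - ?P))
      + (m * (?B - W U x) - m * (W U x - ?A)) / (2 * m) + (W U x - g (U x)) = rate * (T U x - U x)"
    using m_pos eps_pos by (simp add: T_def p_def q_def rate_def field_simps power2_eq_square)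
  ultimately show ?thesis by simp
qed

lemma T_mono:
  assumes "U \<in> profiles" "U' \<in> profiles" "\<And>x. U x \<le> U' x"
  shows "T U x \<le> T U' x"
proof -
  have le: "h (U y) \<le> h (U' y)" if "mono_on {a..b} h" for y h
    using that assms profilesD(2)[OF assms(1)] profilesD(2)[OF assms(2)] by (auto simp: mono_on_def)
  note P = means_mono(1)[OF m_pos bcontfun_p_profile[OF assms(1)] bcontfun_p_profile[OF assms(2)] le[OF mono_p], of x]
  note Q = means_mono(2)[OF m_pos bcontfun_q_profile[OF assms(1)] bcontfun_q_profile[OF assms(2)] le[OF mono_q], of x]
  note W = means_mono[OF m_pos W_bcontfun[OF assms(1)] W_bcontfun[OF assms(2)] W_mono[OF assms], of x]
  show ?thesis
    unfolding T_def using P Q W rate_pos by (intro add_mono divide_right_mono) auto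
qed

text \<open>
  By the identity \<open>p s + q s + g s / rate = s\<close>, the ranges of the averages in \<open>T U\<close> add up to \<open>{a..b}\<close>.
  The derivative of \<open>T U\<close> is \<open>m\<close> times a sum of differences of values in these ranges, so the widths
  add up to the Lipschitz constant \<open>m * (b - a)\<close>.
\<close>
lemma T_in_profiles:
  assumes U: "U \<in> profiles"
  shows "T U \<in> profiles"
proof -
  let ?P = "past_mean m (\<lambda>y. p (U y))" and ?Q = "future_mean m (\<lambda>y. q (U y))"
  let ?A = "past_mean m (W U)" and ?B = "future_mean m (W U)"
  have P: "?P x \<in> {p a..p b}" for x
    by (intro means_bounds m_pos bcontfun_p_profile comp_profile_bounds mono_p U)
  have Q: "?Q x \<in> {q a..q b}" for x
    by (intro means_bounds m_pos bcontfun_q_profile comp_profile_bounds mono_q U)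
  have A: "?A x \<in> {g a..g b}" for x
    by (intro means_bounds m_pos W_bcontfun W_bounds U)
  have B: "?B x \<in> {g a..g b}" for x
    by (intro means_bounds m_pos W_bcontfun W_bounds U)
  have pq: "p s + q s + g s / rate = s" for s
    using rate_pos by (simp add: p_def q_def field_simps)
  have "antimono (T U)"
  proof (rule antimonoI)
    fix x y :: real assume xy: "x \<le> y"
    have "?P y \<le> ?P x" "?Q y \<le> ?Q x" "?A y \<le> ?A x" "?B y \<le> ?B x"
      using means_antimono[OF m_pos bcontfun_p_profile[OF U] antimono_comp_profile[OF U mono_p]]
        means_antimono[OF m_pos bcontfun_q_profile[OF U] antimono_comp_profile[OF U mono_q]]
        means_antimono[OF m_pos W_bcontfun[OF U] W_antimono[OF U]]
      by (simp_all only: antimonoD[OF _ xy])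
    then show "T U y \<le> T U x"
      unfolding T_def using rate_pos by (intro add_mono divide_right_mono) auto
  qed
  moreover have "T U x \<in> {a..b}" for x
  proof -
    have "2 * g a \<le> ?A x + ?B x" "?A x + ?B x \<le> 2 * g b" using A[of x] B[of x] by auto
    then have "g a / rate \<le> (?A x + ?B x) / (2 * rate)" "(?A x + ?B x) / (2 * rate) \<le> g b / rate"
      using rate_pos divide_right_mono[of "2 * g a" _ "2 * rate"] divide_right_mono[of _ "2 * g b" "2 * rate"]
      by simp_all
    then show ?thesis using P[of x] Q[of x] pq[of a] pq[of b] by (simp add: T_def)
  qed
  moreover have "(m * (b - a))-lipschitz_on UNIV (T U)"
  proof (rule bounded_derivative_imp_lipschitz)
    fix x
    show "(T U has_derivative (*) ((F (U x) - V U x + defect U x) / \<epsilon>)) (at x within UNIV)"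
      using T_has_derivative[OF U, of x] by (simp add: has_field_derivative_def)
    have "(F (U x) - V U x + defect U x) / \<epsilon> =
        m * ((p (U x) - ?P x) + (?Q x - q (U x)) + (?B x - ?A x) / (2 * rate))"
      using m_pos eps_pos by (simp add: defect_def p_def q_def rate_def field_simps power2_eq_square)
    moreover have "\<bar>(p (U x) - ?P x) + (?Q x - q (U x)) + (?B x - ?A x) / (2 * rate)\<bar> \<le> b - a"
    proof -
      have "\<bar>p (U x) - ?P x\<bar> \<le> p b - p a" "\<bar>?Q x - q (U x)\<bar> \<le> q b - q a"
        using P[of x] Q[of x] comp_profile_bounds[OF U mono_p, of x] comp_profile_bounds[OF U mono_q, of x]
        by auto
      moreover have "\<bar>(?B x - ?A x) / (2 * rate)\<bar> \<le> g b / rate - g a / rate"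
      proof -
        have "\<bar>?B x - ?A x\<bar> \<le> 2 * (g b - g a)" using A[of x] B[of x] by auto
        then have "\<bar>?B x - ?A x\<bar> / (2 * rate) \<le> 2 * (g b - g a) / (2 * rate)"
          using rate_pos by (intro divide_right_mono) auto
        moreover have "\<bar>?B x - ?A x\<bar> / (2 * rate) = \<bar>(?B x - ?A x) / (2 * rate)\<bar>"
          using rate_pos by (intro abs_div_pos) simp
        moreover have "2 * (g b - g a) / (2 * rate) = g b / rate - g a / rate"
          by (simp add: diff_divide_distrib)
        ultimately show ?thesis by linarith
      qed
      ultimately show ?thesis using pq[of a] pq[of b] by linarith
    qed
    ultimately have "\<bar>(F (U x) - V U x + defect U x) / \<epsilon>\<bar> \<le> m * (b - a)"
      using m_pos by (simp add: abs_mult)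
    then show "onorm ((*) ((F (U x) - V U x + defect U x) / \<epsilon>)) \<le> m * (b - a)"
      by (intro onorm_le) (simp only: real_norm_def abs_mult mult_right_mono abs_ge_zero)
  qed (use m_pos a_less_b in auto)
  ultimately show ?thesis by (simp add: profiles_def)
qed

lemma shift_in_profiles:
  assumes "U \<in> profiles"
  shows "(\<lambda>x. U (x + s)) \<in> profiles"
proof -
  have "dist (U (x + s)) (U (y + s)) \<le> m * (b - a) * dist x y" for x y
    using lipschitz_onD[OF profilesD(3)[OF assms], of "x + s" "y + s"] by (simp add: dist_real_def)
  then show ?thesis
    using profilesD(2,5)[OF assms] m_pos a_less_b
    by (simp add: profiles_def antimono_def lipschitz_on_def)
qed

lemma defect_shift: "defect (\<lambda>x. U (x + s)) x = defect U (x + s)"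
proof -
  have pm: "past_mean k (\<lambda>y. h (y + s)) x = past_mean k h (x + s)"
    and fm: "future_mean k (\<lambda>y. h (y + s)) x = future_mean k h (x + s)" for k h x
    by (simp_all add: past_mean_def future_mean_def algebra_simps)
  have "W (\<lambda>x. U (x + s)) = (\<lambda>x. W U (x + s))"
    by (simp add: W_def fun_eq_iff pm[of _ "\<lambda>y. g (U y)"] fm[of _ "\<lambda>y. g (U y)"])
  then show ?thesis
    by (simp add: defect_def V_def pm[of _ "\<lambda>y. g (U y)"] fm[of _ "\<lambda>y. g (U y)"]
        pm[of _ "\<lambda>y. p (U y)"] fm[of _ "\<lambda>y. q (U y)"] pm[of _ "W U"] fm[of _ "W U"])
qed

context
  fixes X :: "nat \<Rightarrow> real \<Rightarrow> real" and U :: "real \<Rightarrow> real"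
  assumes X: "\<And>n. X n \<in> profiles" and lim: "\<And>x. (\<lambda>n. X n x) \<longlonglongrightarrow> U x"
begin

lemma limit_in_profiles: "U \<in> profiles"
proof -
  have "U y \<le> U x" if "x \<le> y" for x y
    using lim profilesD(5)[OF X that] by (intro LIMSEQ_le[OF lim lim]) auto
  moreover have "U x \<in> {a..b}" for x
    using profilesD(2)[OF X, of _ x] by (intro closed_sequentially[OF closed_atLeastAtMost _ lim]) auto
  moreover have "dist (U x) (U y) \<le> m * (b - a) * dist x y" for x y
    by (rule LIMSEQ_le_const2[OF tendsto_dist[OF lim lim]])
      (use profilesD(3)[OF X] in \<open>auto dest: lipschitz_onD\<close>)
  ultimately show ?thesis
    using m_pos a_less_b by (auto simp: profiles_def antimono_def lipschitz_on_def)
qed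

lemma comp_limit:
  assumes "continuous_on {a..b} h" "k > 0"
  shows "(\<lambda>n. past_mean k (\<lambda>y. h (X n y)) x) \<longlonglongrightarrow> past_mean k (\<lambda>y. h (U y)) x"
    and "(\<lambda>n. future_mean k (\<lambda>y. h (X n y)) x) \<longlonglongrightarrow> future_mean k (\<lambda>y. h (U y)) x"
proof -
  obtain B where B: "\<And>s. s \<in> {a..b} \<Longrightarrow> \<bar>h s\<bar> \<le> B"
    using compact_imp_bounded[OF compact_continuous_image[OF assms(1) compact_Icc]]
    by (force simp: bounded_iff)
  have bound: "\<bar>h (X n y)\<bar> \<le> B" for n y
    using B profilesD(2)[OF X] .
  have pw: "(\<lambda>n. h (X n y)) \<longlonglongrightarrow> h (U y)" for y
    by (rule continuous_on_tendsto_compose[OF assms(1) lim profilesD(2)[OF limit_in_profiles]])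
      (simp only: profilesD(2)[OF X] eventually_True)
  note bc = bcontfun_comp_profile[OF X assms(1)] bcontfun_comp_profile[OF limit_in_profiles assms(1)]
  show "(\<lambda>n. past_mean k (\<lambda>y. h (X n y)) x) \<longlonglongrightarrow> past_mean k (\<lambda>y. h (U y)) x"
    and "(\<lambda>n. future_mean k (\<lambda>y. h (X n y)) x) \<longlonglongrightarrow> future_mean k (\<lambda>y. h (U y)) x"
    using means_dominated_convergence[OF assms(2) bc bound pw] .
qed

lemma W_limit: "(\<lambda>n. W (X n) x) \<longlonglongrightarrow> W U x"
  unfolding W_def by (intro tendsto_intros comp_limit continuous_g) auto

lemma W_means_limit:
  "(\<lambda>n. past_mean m (W (X n)) x) \<longlonglongrightarrow> past_mean m (W U) x"
  "(\<lambda>n. future_mean m (W (X n)) x) \<longlonglongrightarrow> future_mean m (W U) x"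
proof -
  have "\<bar>W (X n) y\<bar> \<le> \<bar>g a\<bar> + \<bar>g b\<bar>" for n y
    using W_bounds[OF X, of n y] by auto
  then show "(\<lambda>n. past_mean m (W (X n)) x) \<longlonglongrightarrow> past_mean m (W U) x"
    "(\<lambda>n. future_mean m (W (X n)) x) \<longlonglongrightarrow> future_mean m (W U) x"
    by (rule means_dominated_convergence[OF m_pos W_bcontfun[OF X] W_bcontfun[OF limit_in_profiles] _ W_limit])+
qed

lemma T_limit: "(\<lambda>n. T (X n) x) \<longlonglongrightarrow> T U x"
  unfolding T_def using rate_pos
  by (intro tendsto_intros comp_limit continuous_p continuous_q m_pos W_means_limit) auto

lemma defect_limit: "(\<lambda>n. defect (X n) x) \<longlonglongrightarrow> defect U x"
  unfolding defect_def V_def using m_pos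
  by (intro tendsto_intros comp_limit continuous_p continuous_q continuous_g W_means_limit) auto

end

section \<open>Truncated profiles and their defect\<close>

text \<open>
  The graph falls from \<open>b\<close> to \<open>a\<close> over the interval from \<open>s\<close> to \<open>s + 1\<close>. A jump would be simpler, but
  would leave the class of Lipschitz profiles.
\<close>
definition ramp :: "real \<Rightarrow> real \<Rightarrow> real" where
  "ramp s x = max a (min b (b - (b - a) * (x - s)))"

definition truncated :: "real \<Rightarrow> (real \<Rightarrow> real) \<Rightarrow> real \<Rightarrow> real" where
  "truncated n U x = max (min (T U x) (ramp n x)) (ramp (- n - 1) x)"

lemma ramp_left: "x \<le> s \<Longrightarrow> ramp s x = b"
  using a_less_b by (simp add: ramp_def mult_nonneg_nonpos)

lemma ramp_right: "x \<ge> s + 1 \<Longrightarrow> ramp s x = a"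
proof -
  assume "x \<ge> s + 1"
  then have "b - a \<le> (b - a) * (x - s)"
    using a_less_b mult_left_mono[of 1 "x - s" "b - a"] by simp
  then show ?thesis unfolding ramp_def by linarith
qed

lemma ramp_in_profiles: "ramp s \<in> profiles"
proof -
  have "ramp s y \<le> ramp s x" if "x \<le> y" for x y
  proof -
    have "(b - a) * (x - s) \<le> (b - a) * (y - s)" using that a_less_b by (intro mult_left_mono) auto
    then show ?thesis by (auto simp: ramp_def)
  qed
  moreover have "dist (ramp s x) (ramp s y) \<le> m * (b - a) * dist x y" for x y
  proof -
    have "dist (ramp s x) (ramp s y) \<le> \<bar>(b - a) * (x - s) - (b - a) * (y - s)\<bar>"
      by (auto simp: ramp_def dist_real_def)
    also have "\<dots> = 1 * (b - a) * dist x y"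
      using a_less_b by (simp add: dist_real_def right_diff_distrib[symmetric] abs_mult)
    also have "\<dots> \<le> m * (b - a) * dist x y"
      using m_ge_1 a_less_b by (intro mult_right_mono) auto
    finally show ?thesis .
  qed
  moreover have "ramp s x \<in> {a..b}" for x using a_less_b by (auto simp: ramp_def)
  ultimately show ?thesis
    using m_pos a_less_b by (auto simp: profiles_def antimono_def lipschitz_on_def)
qed

lemma max_min_in_profiles:
  assumes "U \<in> profiles" "U' \<in> profiles"
  shows "(\<lambda>x. max (U x) (U' x)) \<in> profiles" "(\<lambda>x. min (U x) (U' x)) \<in> profiles"
proof -
  have mm: "\<bar>max u v - max u' v'\<bar> \<le> K" "\<bar>min u v - min u' v'\<bar> \<le> K"
    if "\<bar>u - u'\<bar> \<le> K" "\<bar>v - v'\<bar> \<le> K" for u v u' v' K :: real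
    using that by (auto simp: max_def min_def)
  have "dist (max (U x) (U' x)) (max (U y) (U' y)) \<le> m * (b - a) * dist x y"
    "dist (min (U x) (U' x)) (min (U y) (U' y)) \<le> m * (b - a) * dist x y" for x y
    using lipschitz_onD[OF profilesD(3)[OF assms(1)], of x y] lipschitz_onD[OF profilesD(3)[OF assms(2)], of x y]
    unfolding dist_real_def by (auto intro: mm)
  moreover have "max (U y) (U' y) \<le> max (U x) (U' x)" "min (U y) (U' y) \<le> min (U x) (U' x)"
    if "x \<le> y" for x y
    using profilesD(5)[OF assms(1) that] profilesD(5)[OF assms(2) that]
    by (simp_all only: max.mono min.mono)
  moreover have "max (U x) (U' x) \<in> {a..b}" "min (U x) (U' x) \<in> {a..b}" for x
    using profilesD(2)[OF assms(1), of x] profilesD(2)[OF assms(2), of x] by auto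
  ultimately show "(\<lambda>x. max (U x) (U' x)) \<in> profiles" "(\<lambda>x. min (U x) (U' x)) \<in> profiles"
    using m_pos a_less_b by (simp_all add: profiles_def antimono_def lipschitz_on_def)
qed

lemma truncated_in_profiles:
  assumes "U \<in> profiles"
  shows "truncated n U \<in> profiles"
  unfolding truncated_def[abs_def]
  by (intro max_min_in_profiles T_in_profiles ramp_in_profiles assms)

text \<open>
  Iteration from the largest profile, the constant \<open>b\<close>, decreases by monotonicity of \<open>T\<close>, and its
  pointwise limit is a fixed point because \<open>T\<close> respects bounded pointwise limits.
\<close>
lemma truncated_fixed_point:
  obtains U where "U \<in> profiles" "\<And>x. U x = truncated n U x"
proof -
  define X where "X k = (truncated n ^^ k) (\<lambda>_. b)" for k
  have X_Suc: "X (Suc k) = truncated n (X k)" for k by (simp add: X_def)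
  have X: "X k \<in> profiles" for k
  proof (induction k)
    case 0
    show ?case using a_less_b m_pos by (auto simp: X_def profiles_def antimono_def lipschitz_on_def)
  qed (simp add: X_Suc truncated_in_profiles)
  have dec: "X (Suc k) x \<le> X k x" for k x
  proof (induction k arbitrary: x)
    case 0
    show ?case using profilesD(2)[OF X, of "Suc 0" x] by (simp add: X_def)
  next
    case (Suc k)
    have "T (X (Suc k)) x \<le> T (X k) x" by (rule T_mono[OF X X Suc])
    then have "truncated n (X (Suc k)) x \<le> truncated n (X k) x"
      unfolding truncated_def by (intro max.mono min.mono order_refl)
    then show ?case by (simp only: X_Suc)
  qed
  have "\<exists>l. (\<lambda>k. X k x) \<longlonglongrightarrow> l" for x
  proof -
    have "decseq (\<lambda>k. X k x)" using dec by (simp add: decseq_Suc_iff)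
    moreover have "\<forall>k. a \<le> X k x" using profilesD(2)[OF X] by simp
    ultimately show ?thesis by (rule decseq_convergent) blast
  qed
  then obtain U where U: "\<And>x. (\<lambda>k. X k x) \<longlonglongrightarrow> U x" by metis
  have "U x = truncated n U x" for x
  proof (rule LIMSEQ_unique[OF LIMSEQ_Suc[OF U]])
    show "(\<lambda>k. X (Suc k) x) \<longlonglongrightarrow> truncated n U x"
      unfolding X_Suc truncated_def by (intro tendsto_intros T_limit X U)
  qed
  with limit_in_profiles[OF X U] show ?thesis by (rule that)
qed

context
  fixes U :: "real \<Rightarrow> real" and E :: "real filter" and l :: real
  assumes U: "U \<in> profiles" and E: "E \<in> {at_top, at_bot}" and lim_U: "(U \<longlongrightarrow> l) E"
begin

lemma limit_in_range: "l \<in> {a..b}"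
proof (rule Lim_in_closed_set[OF closed_atLeastAtMost _ _ lim_U])
  show "E \<noteq> bot"
    using E
    by (metis insertE singletonD trivial_limit_at_top_linorder trivial_limit_at_bot_linorder)
qed (simp only: profilesD(2)[OF U] eventually_True)

lemma comp_tendsto:
  assumes "continuous_on {a..b} h"
  shows "((\<lambda>x. h (U x)) \<longlongrightarrow> h l) E"
  by (rule continuous_on_tendsto_compose[OF assms lim_U limit_in_range])
    (simp only: profilesD(2)[OF U] eventually_True)

lemma W_tendsto: "(W U \<longlongrightarrow> g l) E"
proof -
  note lim = means_tendsto_at_ends[OF E zero_less_one bcontfun_g_profile[OF U] comp_tendsto[OF continuous_g]]
  have "(W U \<longlongrightarrow> (g l + g l) / 2) E"
    unfolding W_def[abs_def] by (intro tendsto_intros lim) simp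
  then show ?thesis by simp
qed

lemma V_tendsto: "(V U \<longlongrightarrow> 0) E"
proof -
  note lim = means_tendsto_at_ends[OF E zero_less_one bcontfun_g_profile[OF U] comp_tendsto[OF continuous_g]]
  have "(V U \<longlongrightarrow> (g l - g l) / 2) E"
    unfolding V_def[abs_def] by (intro tendsto_intros lim) simp
  then show ?thesis by simp
qed

text \<open>
  At a state \<open>l\<close> with \<open>F l = 0\<close> the functions \<open>p\<close> and \<open>q\<close> agree, so past and future averages cancel.
\<close>
lemma defect_tendsto:
  assumes "F l = 0"
  shows "(defect U \<longlongrightarrow> 0) E"
proof -
  note P = means_tendsto_at_ends(1)[OF E m_pos bcontfun_p_profile[OF U] comp_tendsto[OF continuous_p]]
  note Q = means_tendsto_at_ends(2)[OF E m_pos bcontfun_q_profile[OF U] comp_tendsto[OF continuous_q]]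
  note WW = means_tendsto_at_ends[OF E m_pos W_bcontfun[OF U] W_tendsto]
  have "(defect U \<longlongrightarrow> \<epsilon> * m * (q l - p l) + (g l - g l) / (2 * m) + 0) E"
    unfolding defect_def[abs_def] using m_pos by (intro tendsto_intros P Q WW V_tendsto) simp
  moreover have "q l = p l" using assms by (simp add: p_def q_def)
  ultimately show ?thesis by simp
qed

end

text \<open>
  To the left of \<open>n\<close> only the lower ramp can act on \<open>T U\<close>, and to the right of \<open>- n\<close> only the upper one.
  This gives the sign of \<open>T U - U\<close>, and on \<open>{- n..n}\<close> both inequalities hold.
\<close>
lemma truncated_fixed_point_ends:
  assumes "\<And>x. U x = truncated n U x" "U \<in> profiles"
  shows "x \<le> - n - 1 \<Longrightarrow> U x = b" "x \<ge> n + 1 \<Longrightarrow> n \<ge> 0 \<Longrightarrow> U x = a"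
    "x \<le> n \<Longrightarrow> T U x \<le> U x" "x \<ge> - n \<Longrightarrow> U x \<le> T U x"
  using assms(1)[of x] profilesD(2)[OF T_in_profiles[OF assms(2)], of x]
    ramp_left[of x n] ramp_left[of x "- n - 1"] ramp_right[of n x] ramp_right[of "- n - 1" x]
  by (auto simp: truncated_def)

text \<open>
  The key estimate. The defect falls from \<open>0\<close> to a constant \<open>- j\<close> on \<open>{- n..n}\<close> and rises back to \<open>0\<close>, so
  its absolute value is at most \<open>j\<close>. On \<open>{- n..n}\<close> the function \<open>\<epsilon> * T U + W U + j * x\<close> has derivative
  \<open>F (U x) \<le> 0\<close>; hence \<open>2 * n * j\<close> is at most the oscillation of \<open>\<epsilon> * T U + W U\<close>, which is bounded
  independently of \<open>n\<close>.
\<close>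
lemma truncated_defect_bound:
  assumes fix_U: "\<And>x. U x = truncated n U x" and U: "U \<in> profiles" and n: "n > 0"
  shows "\<bar>defect U x\<bar> \<le> (\<epsilon> * (b - a) + (g b - g a)) / (2 * n)"
proof -
  note ends = truncated_fixed_point_ends[OF fix_U U]
  note D = defect_has_derivative[OF U]
  have dec: "defect U y \<le> defect U x" if "x \<le> y" "y \<le> n" for x y
  proof (rule DERIV_nonpos_imp_nonincreasing[where f = "defect U", OF that(1)])
    fix z assume "x \<le> z" "z \<le> y"
    then have "rate * (T U z - U z) \<le> 0"
      using ends(3)[of z] that rate_pos by (intro mult_nonneg_nonpos) auto
    with D[of z] show "\<exists>d. (defect U has_real_derivative d) (at z) \<and> d \<le> 0" by blast
  qed
  have inc: "defect U x \<le> defect U y" if "x \<le> y" "- n \<le> x" for x y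
  proof (rule DERIV_nonneg_imp_nondecreasing[where f = "defect U", OF that(1)])
    fix z assume "x \<le> z" "z \<le> y"
    then have "rate * (T U z - U z) \<ge> 0"
      using ends(4)[of z] that rate_pos by (intro mult_nonneg_nonneg) auto
    with D[of z] show "\<exists>d. (defect U has_real_derivative d) (at z) \<and> d \<ge> 0" by blast
  qed
  have top: "(defect U \<longlongrightarrow> 0) at_top"
    by (rule defect_tendsto[OF U _ _ F_a], simp, rule tendsto_eventually)
      (use ends(2) n in \<open>auto simp: eventually_at_top_linorder\<close>)
  have bot: "(defect U \<longlongrightarrow> 0) at_bot"
    by (rule defect_tendsto[OF U _ _ F_b], simp, rule tendsto_eventually)
      (use ends(1) n in \<open>auto simp: eventually_at_bot_linorder\<close>)
  have const: "defect U x = defect U 0" if "- n \<le> x" "x \<le> n" for x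
    using dec[of x 0] inc[of x 0] dec[of 0 x] inc[of 0 x] that n by (cases "x \<le> 0") force+
  have neg: "defect U x \<le> 0" for x
  proof (cases "x \<le> n")
    case True
    have "\<forall>\<^sub>F y in at_bot. defect U x \<le> defect U y"
      using dec[OF _ True] by (auto simp: eventually_at_bot_linorder)
    then show ?thesis by (intro tendsto_lowerbound[OF bot]) auto
  next
    case False
    then have "\<forall>\<^sub>F y in at_top. defect U x \<le> defect U y"
      using inc[of x] n by (auto simp: eventually_at_top_linorder)
    then show ?thesis by (intro tendsto_lowerbound[OF top]) auto
  qed
  have ge: "defect U 0 \<le> defect U x" for x
    using dec[of x 0] inc[of 0 x] n by (cases "x \<le> 0") auto
  define j where "j = - defect U 0"
  define K where "K x = \<epsilon> * T U x + W U x + j * x" for x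
  have "K n \<le> K (- n)"
  proof (rule DERIV_nonpos_imp_nonincreasing[where f = K])
    fix z assume z: "- n \<le> z" "z \<le> n"
    have "(K has_real_derivative \<epsilon> * ((F (U z) - V U z + defect U z) / \<epsilon>) + V U z + j) (at z)"
      unfolding K_def[abs_def]
      by (rule derivative_eq_intros T_has_derivative W_has_derivative U refl | simp)+
    moreover have "\<epsilon> * ((F (U z) - V U z + defect U z) / \<epsilon>) + V U z + j = F (U z)"
      using eps_pos const[OF z] by (simp add: j_def)
    moreover have "F (U z) \<le> 0"
      using profilesD(2)[OF U, of z] F_neg[of "U z"] F_a F_b
      by (cases "U z = a \<or> U z = b") (auto intro: less_imp_le)
    ultimately show "\<exists>d. (K has_real_derivative d) (at z) \<and> d \<le> 0" by auto
  qed (use n in auto)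
  then have "2 * n * j \<le> \<epsilon> * (T U (- n) - T U n) + (W U (- n) - W U n)"
    by (simp add: K_def algebra_simps)
  also have "\<dots> \<le> \<epsilon> * (b - a) + (g b - g a)"
    using profilesD(2)[OF T_in_profiles[OF U], of n] profilesD(2)[OF T_in_profiles[OF U], of "- n"]
      W_bounds[OF U, of n] W_bounds[OF U, of "- n"] eps_pos
    by (intro add_mono mult_left_mono diff_mono) auto
  finally have "j \<le> (\<epsilon> * (b - a) + (g b - g a)) / (2 * n)"
    using n by (simp add: field_simps)
  then show ?thesis using neg[of x] ge[of x] by (simp add: j_def)
qed

text \<open>
  Without a normalisation the transition layer could drift away as \<open>n \<rightarrow> \<infinity>\<close>, leaving a constant limit.
  Placing the midpoint of \<open>{a..b}\<close> at \<open>0\<close> excludes the constants \<open>a\<close> and \<open>b\<close>.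
\<close>
lemma exists_centred_small_defect:
  assumes "n > 0"
  obtains U where "U \<in> profiles" "U 0 = (a + b) / 2"
    "\<And>x. \<bar>defect U x\<bar> \<le> (\<epsilon> * (b - a) + (g b - g a)) / (2 * n)"
proof -
  obtain U where U: "U \<in> profiles" and f: "\<And>x. U x = truncated n U x"
    by (rule truncated_fixed_point) (rule that)
  note ends = truncated_fixed_point_ends[OF f U]
  have "\<exists>s\<ge>- n - 1. s \<le> n + 1 \<and> U s = (a + b) / 2"
    using IVT2'[of U "n + 1" "(a + b) / 2" "- n - 1"] ends(1)[of "- n - 1"] ends(2)[of "n + 1"]
      assms a_less_b continuous_on_subset[OF profilesD(4)[OF U]] by auto
  then obtain s where s: "U s = (a + b) / 2" by blast
  show ?thesis
  proof (rule that)
    show "(\<lambda>x. U (x + s)) \<in> profiles" using U by (rule shift_in_profiles)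
    show "U (0 + s) = (a + b) / 2" using s by simp
    show "\<bar>defect (\<lambda>x. U (x + s)) x\<bar> \<le> (\<epsilon> * (b - a) + (g b - g a)) / (2 * n)" for x
      unfolding defect_shift by (rule truncated_defect_bound[OF f U assms])
  qed
qed

lemma exists_fixed_profile:
  obtains U where "U \<in> profiles" "U 0 = (a + b) / 2" "\<And>x. T U x = U x" "\<And>x. defect U x = 0"
proof -
  let ?C = "\<epsilon> * (b - a) + (g b - g a)"
  have "\<exists>U. U \<in> profiles \<and> U 0 = (a + b) / 2 \<and> (\<forall>x. \<bar>defect U x\<bar> \<le> ?C / (2 * real (Suc n)))" for n
    using exists_centred_small_defect[of "real (Suc n)"] by (metis of_nat_0_less_iff zero_less_Suc)
  then obtain X where X: "\<And>n. X n \<in> profiles" "\<And>n. X n 0 = (a + b) / 2"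
    "\<And>n x. \<bar>defect (X n) x\<bar> \<le> ?C / (2 * real (Suc n))" by metis
  have "\<bar>X n x\<bar> \<le> \<bar>a\<bar> + \<bar>b\<bar>" for n x using profilesD(2)[OF X(1), of n x] by auto
  then obtain k U where k: "strict_mono (k :: nat \<Rightarrow> nat)" and U: "\<And>x. (\<lambda>n. X (k n) x) \<longlonglongrightarrow> U x"
    using equi_lipschitz_convergent_subsequence profilesD(3)[OF X(1)] by metis
  have prof: "U \<in> profiles" by (rule limit_in_profiles[OF X(1) U])
  have U0: "U 0 = (a + b) / 2" using U[of 0] by (simp only: X(2) LIMSEQ_const_iff)
  have small: "(\<lambda>n. ?C / (2 * real (Suc n))) \<longlonglongrightarrow> 0"
    using tendsto_mult[OF tendsto_const LIMSEQ_inverse_real_of_nat, of "?C / 2"]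
    by (simp add: field_simps)
  have d0: "defect U x = 0" for x
  proof (rule LIMSEQ_unique[OF defect_limit[OF X(1) U]])
    show "(\<lambda>n. defect (X (k n)) x) \<longlonglongrightarrow> 0"
      by (rule tendsto_rabs_zero_cancel, rule tendsto_sandwich[OF _ _ tendsto_const LIMSEQ_subseq_LIMSEQ[OF small k]])
        (auto intro!: always_eventually simp del: of_nat_Suc simp: X(3))
  qed
  have "defect U = (\<lambda>_. 0)" using d0 by blast
  then have "(defect U has_real_derivative 0) (at x)" for x by simp
  from DERIV_unique[OF defect_has_derivative[OF prof] this] have "T U x = U x" for x
    using rate_pos by simp
  with prof U0 show ?thesis using d0 by (rule that)
qed

text \<open>
  If a solution of the first order equation has a limit \<open>l\<close> at one end, then \<open>U'\<close> tends to \<open>F l / \<epsilon>\<close>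
  there, so \<open>F l = 0\<close> and \<open>l\<close> is \<open>a\<close> or \<open>b\<close>. Monotonicity and the value at \<open>0\<close> decide which.
\<close>
theorem exists_front:
  obtains U where "U \<in> profiles" "(U \<longlongrightarrow> b) at_bot" "(U \<longlongrightarrow> a) at_top"
    "\<And>x. (U has_real_derivative (F (U x) - V U x) / \<epsilon>) (at x)"
proof -
  obtain U where U: "U \<in> profiles" "U 0 = (a + b) / 2" and TU: "\<And>x. T U x = U x" "\<And>x. defect U x = 0"
    by (rule exists_fixed_profile) (rule that)
  have "T U = U" using TU(1) by blast
  then have D: "(U has_real_derivative (F (U x) - V U x) / \<epsilon>) (at x)" for x
    using T_has_derivative[OF U(1), of x] by (simp add: TU(2))
  have F0: "l = a \<or> l = b" if "F l = 0" "l \<in> {a..b}" for l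
    using F_neg[of l] that by fastforce
  have "(U \<longlongrightarrow> a) at_top"
  proof -
    have "a \<le> U x" for x using profilesD(2)[OF U(1)] by simp
    from antimono_tendsto_at_top[OF profilesD(1)[OF U(1)] this]
    obtain l where l: "(U \<longlongrightarrow> l) at_top" "l \<le> U 0" by blast
    have "((\<lambda>x. (F (U x) - V U x) / \<epsilon>) \<longlongrightarrow> (F l - 0) / \<epsilon>) at_top"
      by (intro tendsto_intros comp_tendsto[OF U(1) _ l(1) continuous_F] V_tendsto[OF U(1) _ l(1)])
        (use eps_pos in simp_all)
    from tendsto_derivative_eq_0[OF D l(1) this] have "F l = 0" using eps_pos by simp
    with F0[of l] limit_in_range[OF U(1) _ l(1)] l(2) U(2) a_less_b have "l = a" by auto
    with l(1) show ?thesis by simp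
  qed
  moreover have "(U \<longlongrightarrow> b) at_bot"
  proof -
    have anti: "antimono (\<lambda>x. - U (- x))"
      using profilesD(5)[OF U(1)] by (auto simp: antimono_def)
    have "- b \<le> - U (- x)" for x using profilesD(2)[OF U(1)] by simp
    from antimono_tendsto_at_top[OF anti this]
    obtain l' where l': "((\<lambda>x. - U (- x)) \<longlongrightarrow> l') at_top" "\<forall>x. l' \<le> - U (- x)" by blast
    define l where "l = - l'"
    have l: "(U \<longlongrightarrow> l) at_bot" "U 0 \<le> l"
      using tendsto_minus[OF l'(1)] spec[OF l'(2), of 0] by (simp_all add: l_def filterlim_at_bot_mirror)
    have "((\<lambda>x. (F (U x) - V U x) / \<epsilon>) \<longlongrightarrow> (F l - 0) / \<epsilon>) at_bot"
      by (intro tendsto_intros comp_tendsto[OF U(1) _ l(1) continuous_F] V_tendsto[OF U(1) _ l(1)])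
        (use eps_pos in simp_all)
    then have lim: "((\<lambda>x. - ((F (U (- x)) - V U (- x)) / \<epsilon>)) \<longlongrightarrow> - (F l / \<epsilon>)) at_top"
      by (auto simp: filterlim_at_bot_mirror intro: tendsto_minus)
    have D': "((\<lambda>x. U (- x)) has_real_derivative - ((F (U (- x)) - V U (- x)) / \<epsilon>)) (at x)" for x
      using DERIV_chain2[OF D[of "- x"] DERIV_minus[OF DERIV_ident]] by simp
    have "- (F l / \<epsilon>) = 0"
      by (rule tendsto_derivative_eq_0[OF D' _ lim]) (use l(1) in \<open>simp add: filterlim_at_bot_mirror\<close>)
    then have "F l = 0" using eps_pos by simp
    with F0[of l] limit_in_range[OF U(1) _ l(1)] l(2) U(2) a_less_b have "l = b" by auto
    with l(1) show ?thesis by simp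
  qed
  ultimately show ?thesis using that[OF U(1)] D by blast
qed

end

section \<open>Fronts of the parabolic-elliptic system\<close>

text \<open>
  For differentiable data on the compact interval \<open>{a..b}\<close> the rate \<open>m\<close> can be chosen large enough for
  the monotone setting.
\<close>
lemma exists_viscous_profile:
  fixes F F' g g' :: "real \<Rightarrow> real"
  assumes "a < b" "\<epsilon> > 0"
    and F': "\<And>s. (F has_real_derivative F' s) (at s)" "continuous_on {a..b} F'"
    and g': "\<And>s. (g has_real_derivative g' s) (at s)" "continuous_on {a..b} g'" "\<And>s. g' s \<ge> 0"
    and F: "F a = 0" "F b = 0" "\<And>s. a < s \<Longrightarrow> s < b \<Longrightarrow> F s < 0"
  obtains U V W where "(U \<longlongrightarrow> b) at_bot" "(V \<longlongrightarrow> 0) at_bot" "(U \<longlongrightarrow> a) at_top" "(V \<longlongrightarrow> 0) at_top"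
    "\<And>x. (U has_real_derivative (F (U x) - V x) / \<epsilon>) (at x)"
    "\<And>x. (V has_real_derivative W x - g (U x)) (at x)"
    "\<And>x. (W has_real_derivative V x) (at x)"
proof -
  obtain A where A: "\<And>s. s \<in> {a..b} \<Longrightarrow> \<bar>F' s\<bar> \<le> A"
    using compact_imp_bounded[OF compact_continuous_image[OF F'(2) compact_Icc]]
    by (force simp: bounded_iff)
  obtain B where B: "\<And>s. s \<in> {a..b} \<Longrightarrow> \<bar>g' s\<bar> \<le> B"
    using compact_imp_bounded[OF compact_continuous_image[OF g'(2) compact_Icc]]
    by (force simp: bounded_iff)
  have AB: "A \<ge> 0" "B \<ge> 0" using A[of a] B[of a] \<open>a < b\<close> by auto
  \<comment> \<open>The derivatives of \<open>p\<close> and \<open>q\<close> are at least \<open>1 / 2 - (A + B) / (2 * \<epsilon> * m)\<close> when \<open>m \<ge> 1\<close>.\<close>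
  define m where "m = 1 + (A + B) / \<epsilon>"
  have m: "m \<ge> 1" using AB \<open>\<epsilon> > 0\<close> by (simp add: m_def)
  have "\<epsilon> * m = \<epsilon> + (A + B)" using \<open>\<epsilon> > 0\<close> by (simp add: m_def field_simps)
  then have em: "A + B \<le> \<epsilon> * m" using \<open>\<epsilon> > 0\<close> by simp
  have pos: "\<epsilon> * m > 0" using m \<open>\<epsilon> > 0\<close> by simp
  have small: "g' s / (2 * (\<epsilon> * m\<^sup>2)) + \<bar>F' s / (2 * \<epsilon> * m)\<bar> \<le> 1 / 2" if "s \<in> {a..b}" for s
  proof -
    have "\<epsilon> * m * 1 \<le> \<epsilon> * m * m" using m pos by (intro mult_left_mono) auto
    then have "2 * (\<epsilon> * m) \<le> 2 * (\<epsilon> * m\<^sup>2)" by (simp add: power2_eq_square mult.assoc)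
    then have "g' s / (2 * (\<epsilon> * m\<^sup>2)) \<le> B / (2 * (\<epsilon> * m))"
      using g'(3)[of s] B[OF that] pos AB by (intro frac_le) auto
    moreover have "\<bar>F' s / (2 * \<epsilon> * m)\<bar> \<le> A / (2 * (\<epsilon> * m))"
      using A[OF that] pos by (simp add: abs_divide divide_right_mono mult.assoc)
    moreover have "B / (2 * (\<epsilon> * m)) + A / (2 * (\<epsilon> * m)) \<le> 1 / 2"
      using em pos by (simp add: add_divide_distrib[symmetric] field_simps)
    ultimately show ?thesis by linarith
  qed
  interpret viscous_front_problem F g a b \<epsilon> m
  proof
    show "continuous_on {a..b} F" "continuous_on {a..b} g"
      using F'(1) g'(1) by (auto intro!: continuous_at_imp_continuous_on DERIV_isCont)
    show "mono_on {a..b} g" by (rule mono_on_of_derivative_nonneg[OF g'(1) g'(3)])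
    show "mono_on {a..b} (\<lambda>s. s / 2 - g s / (2 * (\<epsilon> * m\<^sup>2)) + F s / (2 * \<epsilon> * m))"
    proof (rule mono_on_of_derivative_nonneg)
      fix s assume s: "s \<in> {a..b}"
      show "((\<lambda>s. s / 2 - g s / (2 * (\<epsilon> * m\<^sup>2)) + F s / (2 * \<epsilon> * m)) has_real_derivative
        1 / 2 - g' s / (2 * (\<epsilon> * m\<^sup>2)) + F' s / (2 * \<epsilon> * m)) (at s)"
        by (intro DERIV_add DERIV_diff DERIV_cdivide DERIV_ident F'(1) g'(1))
      show "1 / 2 - g' s / (2 * (\<epsilon> * m\<^sup>2)) + F' s / (2 * \<epsilon> * m) \<ge> 0" using small[OF s] by linarith
    qed
    show "mono_on {a..b} (\<lambda>s. s / 2 - g s / (2 * (\<epsilon> * m\<^sup>2)) - F s / (2 * \<epsilon> * m))"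
    proof (rule mono_on_of_derivative_nonneg)
      fix s assume s: "s \<in> {a..b}"
      show "((\<lambda>s. s / 2 - g s / (2 * (\<epsilon> * m\<^sup>2)) - F s / (2 * \<epsilon> * m)) has_real_derivative
        1 / 2 - g' s / (2 * (\<epsilon> * m\<^sup>2)) - F' s / (2 * \<epsilon> * m)) (at s)"
        by (intro DERIV_add DERIV_diff DERIV_cdivide DERIV_ident F'(1) g'(1))
      show "1 / 2 - g' s / (2 * (\<epsilon> * m\<^sup>2)) - F' s / (2 * \<epsilon> * m) \<ge> 0" using small[OF s] by linarith
    qed
  qed (use assms m in auto)
  obtain U where U: "U \<in> profiles" "(U \<longlongrightarrow> b) at_bot" "(U \<longlongrightarrow> a) at_top"
    "\<And>x. (U has_real_derivative (F (U x) - V U x) / \<epsilon>) (at x)"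
    by (rule exists_front) (rule that)
  show ?thesis
    by (rule that[of U "V U" "W U"])
      (use U in \<open>auto intro: V_tendsto V_has_derivative W_has_derivative\<close>)
qed

text \<open>
  The integrated equation is differentiated once: its right-hand side is \<open>C\<^sup>1\<close>, so \<open>U\<close> and \<open>V\<close> are \<open>C\<^sup>2\<close>.
  The constant of integration \<open>k\<close> disappears in the process.
\<close>
lemma classical_solution_travelling_wave:
  fixes f g f' g' U V W :: "real \<Rightarrow> real" and k c \<epsilon> :: real
  defines "F \<equiv> \<lambda>s. f s - c * s - k"
  assumes "\<epsilon> > 0"
    and f': "\<And>s. (f has_real_derivative f' s) (at s)" "continuous_on UNIV f'"
    and g': "\<And>s. (g has_real_derivative g' s) (at s)" "continuous_on UNIV g'"
    and U: "\<And>x. (U has_real_derivative (F (U x) - V x) / \<epsilon>) (at x)"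
    and V: "\<And>x. (V has_real_derivative W x - g (U x)) (at x)"
    and W: "\<And>x. (W has_real_derivative V x) (at x)"
  shows "classical_solution f g \<epsilon> (\<lambda>t x. U (x - c * t)) (\<lambda>t x. V (x - c * t))"
proof -
  define U1 where "U1 x = (F (U x) - V x) / \<epsilon>" for x
  define V1 where "V1 x = W x - g (U x)" for x
  define U2 where "U2 x = ((f' (U x) - c) * U1 x - V1 x) / \<epsilon>" for x
  define V2 where "V2 x = V x - g' (U x) * U1 x" for x
  have F: "(F has_real_derivative f' s - c) (at s)" for s
    unfolding F_def by (rule derivative_eq_intros f'(1) refl | simp)+
  have dU: "(U has_real_derivative U1 x) (at x)" for x using U by (simp add: U1_def)
  have dV: "(V has_real_derivative V1 x) (at x)" for x using V by (simp add: V1_def)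
  have dU1: "(U1 has_real_derivative U2 x) (at x)" for x
    unfolding U1_def[abs_def] U2_def
    by (intro DERIV_cdivide DERIV_diff DERIV_chain2[OF F] dV dU[unfolded U1_def])
  have dV1: "(V1 has_real_derivative V2 x) (at x)" for x
    unfolding V1_def[abs_def] V2_def by (intro DERIV_diff DERIV_chain2[OF g'(1)] dU W)
  have cont: "continuous_on UNIV U" "continuous_on UNIV V" "continuous_on UNIV U1" "continuous_on UNIV V1"
    using dU dV dU1 dV1 by (auto intro!: continuous_at_imp_continuous_on DERIV_isCont)
  have cont2: "continuous_on UNIV U2" "continuous_on UNIV V2"
    unfolding U2_def[abs_def] V2_def[abs_def] using \<open>\<epsilon> > 0\<close>
    by (auto intro!: continuous_intros cont continuous_on_compose2[OF f'(2)] continuous_on_compose2[OF g'(2)])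
  have joint: "jointly_continuous (\<lambda>t x. h (x - c * t))" if "continuous_on UNIV h" for h
    unfolding jointly_continuous_def case_prod_beta
    by (rule continuous_on_compose2[OF that]) (auto intro!: continuous_intros)
  have space: "((\<lambda>y. h (y - c * t)) has_real_derivative h' (x - c * t)) (at x)"
    if "\<And>x. (h has_real_derivative h' x) (at x)" for h h' t x
  proof -
    have "((\<lambda>y. y - c * t) has_real_derivative 1) (at x)" by (auto intro!: derivative_eq_intros)
    from DERIV_chain2[OF that this] show ?thesis by simp
  qed
  have time: "((\<lambda>s. U (x - c * s)) has_real_derivative - c * U1 (x - c * t)) (at t)" for t x
  proof -
    have "((\<lambda>s. x - c * s) has_real_derivative - c) (at t)"
      by (rule derivative_eq_intros refl | simp)+
    from DERIV_chain2[OF dU this] show ?thesis by (simp add: mult.commute)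
  qed
  have fU: "((\<lambda>y. f (U (y - c * t))) has_real_derivative f' (U (x - c * t)) * U1 (x - c * t)) (at x)"
    and gU: "((\<lambda>y. g (U (y - c * t))) has_real_derivative g' (U (x - c * t)) * U1 (x - c * t)) (at x)" for t x
    by (intro DERIV_chain2[OF f'(1)] DERIV_chain2[OF g'(1)] space dU)+
  have momentum: "- c * U1 y + f' (U y) * U1 y - \<epsilon> * U2 y = V1 y" for y
  proof -
    have "\<epsilon> * U2 y = (f' (U y) - c) * U1 y - V1 y" using \<open>\<epsilon> > 0\<close> by (simp add: U2_def)
    then show ?thesis by (simp add: algebra_simps)
  qed
  show ?thesis
    unfolding classical_solution_def
  proof (intro exI conjI allI)
    let ?at = "\<lambda>h t x. h (x - c * t)"
    show "\<forall>h \<in> {\<lambda>t x. U (x - c * t), \<lambda>t x. - c * U1 (x - c * t), ?at U1, ?at U2,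
        \<lambda>t x. V (x - c * t), ?at V1, ?at V2}. jointly_continuous h"
      using joint cont cont2 joint[OF continuous_on_mult[OF continuous_on_const cont(3)], of "- c"]
      by simp
    fix t x
    show "((\<lambda>s. U (x - c * s)) has_real_derivative - c * U1 (x - c * t)) (at t)" by (rule time)
    show "((\<lambda>y. U (y - c * t)) has_real_derivative U1 (x - c * t)) (at x)" by (rule space[OF dU])
    show "((\<lambda>y. U1 (y - c * t)) has_real_derivative U2 (x - c * t)) (at x)" by (rule space[OF dU1])
    show "((\<lambda>y. V (y - c * t)) has_real_derivative V1 (x - c * t)) (at x)" by (rule space[OF dV])
    show "((\<lambda>y. V1 (y - c * t)) has_real_derivative V2 (x - c * t)) (at x)" by (rule space[OF dV1])
    show "(\<lambda>y. f (U (y - c * t))) differentiable (at x)" "(\<lambda>y. g (U (y - c * t))) differentiable (at x)"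
      using fU gU real_differentiable_def by blast+
    show "- c * U1 (x - c * t) + deriv (\<lambda>y. f (U (y - c * t))) x - \<epsilon> * U2 (x - c * t) = V1 (x - c * t)"
      using momentum[of "x - c * t"] by (simp only: DERIV_imp_deriv[OF fU])
    show "V (x - c * t) - V2 (x - c * t) = deriv (\<lambda>y. g (U (y - c * t))) x"
      by (simp add: DERIV_imp_deriv[OF gU] V2_def)
  qed
qed

theorem theorem1p2:
  fixes f g :: "real \<Rightarrow> real" and um up c :: real
  assumes "f C2_differentiable_on UNIV" and "g C1_differentiable_on UNIV"
    and "\<And>s. deriv (deriv f) s > 0" and "\<And>s. deriv g s > 0"
    and "up \<noteq> um"
    and "c = (f up - f um) / (up - um)"
    and "deriv f up < c" and "c < deriv f um"
    and "inviscid_sub_shock f g c um up"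
  shows "\<exists>\<epsilon>0>0. \<forall>\<epsilon>. 0 < \<epsilon> \<and> \<epsilon> < \<epsilon>0 \<longrightarrow> (\<exists>U V. propagating_front f g \<epsilon> um up U V c)"
proof -
  obtain f' f'' where f': "\<And>s. (f has_real_derivative f' s) (at s)"
    and f'': "\<And>s. (f' has_real_derivative f'' s) (at s)"
    using assms(1) unfolding C2_differentiable_on_def C1_differentiable_on_def
    by (auto simp: has_real_derivative_iff_has_vector_derivative)
  obtain g' where g': "\<And>s. (g has_real_derivative g' s) (at s)" "continuous_on UNIV g'"
    using assms(2) unfolding C1_differentiable_on_def
    by (auto simp: has_real_derivative_iff_has_vector_derivative)
  have derivs: "deriv f = f'" "deriv f' = f''" "deriv g = g'"
    using f' f'' g'(1) by (auto intro!: DERIV_imp_deriv)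
  have cont_f': "continuous_on UNIV f'"
    using f'' by (auto intro!: continuous_at_imp_continuous_on DERIV_isCont)
  have incr: "f' x < f' y" if "x < y" for x y
    using DERIV_pos_imp_increasing[OF that, of f'] f'' assms(3) derivs by metis
  have "up < um"
    using assms(5,7,8) incr[of um up] derivs by (cases "up < um") auto
  define F where "F s = f s - c * s - (f um - c * um)" for s
  have dF: "(F has_real_derivative f' s - c) (at s)" for s
    unfolding F_def by (rule derivative_eq_intros f' refl | simp)+
  have "c * (up - um) = f up - f um" using assms(5,6) by simp
  then have F0: "F up = 0" "F um = 0" by (simp_all add: F_def algebra_simps)
  have neg: "F s < 0" if "up < s" "s < um" for s
    using negative_between_zeros[OF dF _ F0 that] incr by (simp add: strict_mono_def)
  have "\<exists>U V. propagating_front f g \<epsilon> um up U V c" if eps: "0 < \<epsilon>" for \<epsilon>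
  proof -
    obtain U V W where UVW: "(U \<longlongrightarrow> um) at_bot" "(V \<longlongrightarrow> 0) at_bot" "(U \<longlongrightarrow> up) at_top" "(V \<longlongrightarrow> 0) at_top"
      "\<And>x. (U has_real_derivative (F (U x) - V x) / \<epsilon>) (at x)"
      "\<And>x. (V has_real_derivative W x - g (U x)) (at x)"
      "\<And>x. (W has_real_derivative V x) (at x)"
    proof (rule exists_viscous_profile[OF \<open>up < um\<close> eps dF _ g'(1) _ _ F0 neg])
      show "continuous_on {up..um} (\<lambda>s. f' s - c)"
        by (intro continuous_intros continuous_on_subset[OF cont_f']) simp
      show "continuous_on {up..um} g'" by (rule continuous_on_subset[OF g'(2)]) simp
      show "g' s \<ge> 0" for s using assms(4)[of s] derivs by simp
    qed (assumption | rule that)+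
    have "classical_solution f g \<epsilon> (\<lambda>t x. U (x - c * t)) (\<lambda>t x. V (x - c * t))"
      using UVW(5-7) unfolding F_def
      by (intro classical_solution_travelling_wave[OF eps f' cont_f' g'])
    with UVW(1-4) show ?thesis unfolding propagating_front_def by blast
  qed
  \<comment> \<open>The front exists for each \<open>\<epsilon> > 0\<close>, so any positive threshold serves.\<close>
  then show ?thesis by (intro exI[of _ 1]) auto
qed

end
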